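(* Let $(X,\nabla,g)$ be a compact Hessian manifold of dimension $d$ presented as $X=\Omega/G$, where $\Omega\subset\mathbb{R}^d$ is a non-empty open convex set, $G$ is a group of affine transformations of $\mathbb{R}^d$ preserving $\Omega$, the quotient map $p:\Omega\to X$ is the universal covering, and $\nabla$ is the connection induced on $X$ by the standard flat connection of $\mathbb{R}^d$. Let $\Phi:\Omega\to\mathbb{R}$ be a smooth, strictly convex function whose Hessian is the pullback $p^*g$, and let $G$ act on $\partial\Phi(\Omega)\subset(\mathbb{R}^d)^*$ by the action pushed forward from $\Omega$, i.e. $h\cdot\partial\Phi(m)=\partial\Phi(h m)$ for $h\in G$, $m\in\Omega$. Then $\partial\Phi(\Omega)/G$, equipped with the affine structure inherited from $(\mathbb{R}^d)^*$, is affinely isomorphic to $(X,\nabla')$, where $(X,\nabla',g)$ is the dual Hessian manifold of $(X,\nabla,g)$.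
   Context: An affine structure on a smooth manifold $X$ is a flat torsion-free connection $\nabla$ on $TX$ (equivalently, an atlas, the distinguished atlas, whose transition functions are affine; its charts are called affine coordinates). An affine isomorphism between affine manifolds is a diffeomorphism carrying one connection to the other. A Hessian metric on $(X,\nabla)$ is a Riemannian metric $g$ which locally, in affine coordinates $x_1,\dots,x_d$, has the form $g=\nabla d\phi=\sum_{j,k}\frac{\partial^2\phi}{\partial x_j\partial x_k}dx_j\otimes dx_k$ for a smooth convex function $\phi$ (a potential of $g$). Then $(X,\nabla,g)$ is called a Hessian manifold. For a smooth strictly convex function $\Phi$ on $\Omega$ with positive definite Hessian, $\partial\Phi:\Omega\to(\mathbb{R}^d)^*$ denotes the gradient map $x\mapsto d\Phi_x$, which is a diffeomorphism onto its image $\partial\Phi(\Omega)$. The dual of a Hessian manifold $(X,\nabla,g)$ is the Hessian manifold $(X,\nabla',g)$ with $\nabla'=2\nabla_g-\nabla$, where $\nabla_g$ is the Levi-Civita connection of $g$. Equivalently, on a convex affine coordinate chart with local potential $\phi$ of $g$, $\nabla'$ is the pullback of the standard flat connection on $(\mathbb{R}^d)^*$ by the gradient map $\partial\phi$. (Both descriptions are known to agree and to give a well-defined flat torsion-free connection on $X$ for which $g$ is a Hessian metric.) *)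

theory Defs
  imports "HOL-Analysis.Analysis"
begin

section \<open>Smooth maps between open subsets of normed spaces\<close>

text \<open>Both notions are meant for functions on an open set \<open>S\<close> of a finite-dimensional space, where
  continuity of all iterated directional derivatives is the usual \<open>C\<^sup>k\<close> condition. Normed spaces
  (rather than euclidean spaces) are used so that charts may also take values in the dual space
  \<open>'a \<Rightarrow>\<^sub>L real\<close>.\<close>

primrec Ck_on :: "nat \<Rightarrow> ('a::real_normed_vector \<Rightarrow> 'b::real_normed_vector) \<Rightarrow> 'a set \<Rightarrow> bool" where
  "Ck_on 0 f S \<longleftrightarrow> continuous_on S f"
| "Ck_on (Suc k) f S \<longleftrightarrow>
     (\<forall>x\<in>S. f differentiable (at x)) \<and> (\<forall>v. Ck_on k (\<lambda>x. frechet_derivative f (at x) v) S)"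

definition smooth_on :: "('a::real_normed_vector \<Rightarrow> 'b::real_normed_vector) \<Rightarrow> 'a set \<Rightarrow> bool" where
  "smooth_on f S \<longleftrightarrow> (\<forall>k. Ck_on k f S)"

definition derivative1 :: "('a::real_normed_vector \<Rightarrow> 'b::real_normed_vector) \<Rightarrow> 'a \<Rightarrow> 'a \<Rightarrow> 'b" where
  "derivative1 f x u = frechet_derivative f (at x) u"

text \<open>For real-valued \<open>f\<close> this is the Hessian of \<open>f\<close> as a bilinear form.\<close>

definition derivative2 :: "('a::real_normed_vector \<Rightarrow> 'b::real_normed_vector) \<Rightarrow> 'a \<Rightarrow> 'a \<Rightarrow> 'a \<Rightarrow> 'b" where
  "derivative2 f x u v = derivative1 (\<lambda>z. derivative1 f z v) x u"

definition gradient_map :: "('a::real_normed_vector \<Rightarrow> real) \<Rightarrow> 'a \<Rightarrow> ('a \<Rightarrow>\<^sub>L real)" where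
  "gradient_map f x = Blinfun (frechet_derivative f (at x))"

definition strictly_convex_on :: "'a::real_vector set \<Rightarrow> ('a \<Rightarrow> real) \<Rightarrow> bool" where
  "strictly_convex_on S f \<longleftrightarrow> convex S \<and>
     (\<forall>x\<in>S. \<forall>y\<in>S. \<forall>u>0. \<forall>v>0. x \<noteq> y \<longrightarrow> u + v = 1 \<longrightarrow> f (u *\<^sub>R x + v *\<^sub>R y) < u * f x + v * f y)"


section \<open>Smooth manifolds\<close>

type_synonym ('x, 'e) chart = "'x set \<times> ('x \<Rightarrow> 'e)"

text \<open>The atlas need not be maximal: it determines the smooth structure, and tensors and connections
  are given by their components in the charts of the atlas.\<close>

record ('x, 'e) manifold =
  mtop :: "'x topology"
  atlas :: "('x, 'e) chart set"

definition is_chart :: "'x topology \<Rightarrow> ('x, 'e::real_normed_vector) chart \<Rightarrow> bool" where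
  "is_chart T c \<longleftrightarrow> openin T (fst c) \<and> open (snd c ` fst c) \<and>
     homeomorphic_map (subtopology T (fst c)) (top_of_set (snd c ` fst c)) (snd c)"

text \<open>The coordinate expression of \<open>f\<close> in the charts \<open>c\<close> (source) and \<open>c'\<close> (target), and its
  domain. For \<open>f = id\<close> this is the transition map.\<close>

definition local_rep :: "('x, 'e) chart \<Rightarrow> ('y, 'f) chart \<Rightarrow> ('x \<Rightarrow> 'y) \<Rightarrow> 'e \<Rightarrow> 'f" where
  "local_rep c c' f = snd c' \<circ> f \<circ> inv_into (fst c) (snd c)"

definition local_dom :: "('x, 'e) chart \<Rightarrow> ('y, 'f) chart \<Rightarrow> ('x \<Rightarrow> 'y) \<Rightarrow> 'e set" where
  "local_dom c c' f = snd c ` {x \<in> fst c. f x \<in> fst c'}"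

definition smooth_manifold :: "('x, 'e::real_normed_vector) manifold \<Rightarrow> bool" where
  "smooth_manifold M \<longleftrightarrow>
     Hausdorff_space (mtop M) \<and> second_countable (mtop M) \<and>
     (\<forall>c\<in>atlas M. is_chart (mtop M) c) \<and>
     topspace (mtop M) = (\<Union>c\<in>atlas M. fst c) \<and>
     (\<forall>c\<in>atlas M. \<forall>c'\<in>atlas M. smooth_on (local_rep c c' id) (local_dom c c' id))"

definition smooth_map ::
  "('x, 'e::real_normed_vector) manifold \<Rightarrow> ('y, 'f::real_normed_vector) manifold \<Rightarrow> ('x \<Rightarrow> 'y) \<Rightarrow> bool" where
  "smooth_map M N f \<longleftrightarrow> continuous_map (mtop M) (mtop N) f \<and>
     (\<forall>c\<in>atlas M. \<forall>c'\<in>atlas N. smooth_on (local_rep c c' f) (local_dom c c' f))"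

definition diffeomorphism ::
  "('x, 'e::real_normed_vector) manifold \<Rightarrow> ('y, 'f::real_normed_vector) manifold \<Rightarrow> ('x \<Rightarrow> 'y) \<Rightarrow> bool" where
  "diffeomorphism M N f \<longleftrightarrow> (\<exists>f'. smooth_map M N f \<and> smooth_map N M f' \<and>
     (\<forall>x\<in>topspace (mtop M). f' (f x) = x) \<and> (\<forall>y\<in>topspace (mtop N). f (f' y) = y))"

definition open_submanifold :: "('x, 'e) manifold \<Rightarrow> 'x set \<Rightarrow> ('x, 'e) manifold" where
  "open_submanifold M V =
     \<lparr>mtop = subtopology (mtop M) V, atlas = (\<lambda>(U, \<phi>). (U \<inter> V, \<phi>)) ` atlas M\<rparr>"

definition domain_manifold :: "'e::real_normed_vector set \<Rightarrow> ('e, 'e) manifold" where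
  "domain_manifold S = \<lparr>mtop = top_of_set S, atlas = {(S, id)}\<rparr>"

definition smooth_covering ::
  "('x, 'e::real_normed_vector) manifold \<Rightarrow> ('y, 'f::real_normed_vector) manifold \<Rightarrow> ('x \<Rightarrow> 'y) \<Rightarrow> bool" where
  "smooth_covering M N p \<longleftrightarrow>
     smooth_map M N p \<and> p ` topspace (mtop M) = topspace (mtop N) \<and>
     (\<forall>y\<in>topspace (mtop N). \<exists>U. y \<in> U \<and> openin (mtop N) U \<and>
        (\<exists>\<V>. \<Union>\<V> = {x \<in> topspace (mtop M). p x \<in> U} \<and> pairwise disjnt \<V> \<and>
             (\<forall>V\<in>\<V>. openin (mtop M) V \<and>
                diffeomorphism (open_submanifold M V) (open_submanifold N U) p)))"

definition universal_covering ::
  "'e::real_normed_vector set \<Rightarrow> ('y, 'f::real_normed_vector) manifold \<Rightarrow> ('e \<Rightarrow> 'y) \<Rightarrow> bool" where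
  "universal_covering S N p \<longleftrightarrow> simply_connected S \<and> smooth_covering (domain_manifold S) N p"


section \<open>Connections and affine structures\<close>

text \<open>A connection on the tangent bundle is given by its Christoffel symbols in the charts of the
  atlas: in the chart \<open>c\<close>, \<open>\<nabla>\<^sub>u V = D V(u) + \<Gamma> c y u V\<close> at the point with coordinates \<open>y\<close>. Likewise
  \<open>g c y u v\<close> are the components of a metric \<open>g\<close>. Only values for \<open>c\<close> in the atlas and \<open>y\<close> in its
  image are relevant.\<close>

type_synonym ('x, 'e) connection = "('x, 'e) chart \<Rightarrow> 'e \<Rightarrow> 'e \<Rightarrow> 'e \<Rightarrow> 'e"
type_synonym ('x, 'e) metric = "('x, 'e) chart \<Rightarrow> 'e \<Rightarrow> 'e \<Rightarrow> 'e \<Rightarrow> real"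

text \<open>\<open>f\<close> carries one connection to the other, i.e. \<open>df (\<nabla>\<^sub>u V) = \<nabla>'\<^bsub>df u\<^esub> (df V)\<close>, in coordinates
  \<open>D\<tau>(\<Gamma>(u, v)) = D\<^sup>2\<tau>(u, v) + \<Gamma>'(D\<tau> u, D\<tau> v)\<close>. For a local diffeomorphism \<open>f\<close> this says that the
  first connection is the pullback of the second one; for \<open>f = id\<close> it is the transformation law of
  Christoffel symbols.\<close>

definition carries_connection ::
  "('x, 'e::real_normed_vector) manifold \<Rightarrow> ('x, 'e) connection \<Rightarrow>
   ('y, 'f::real_normed_vector) manifold \<Rightarrow> ('y, 'f) connection \<Rightarrow> ('x \<Rightarrow> 'y) \<Rightarrow> bool" where
  "carries_connection M \<Gamma> N \<Gamma>' f \<longleftrightarrow>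
     (\<forall>c\<in>atlas M. \<forall>c'\<in>atlas N. \<forall>y\<in>local_dom c c' f. \<forall>u v.
        let \<tau> = local_rep c c' f in
        derivative1 \<tau> y (\<Gamma> c y u v) =
          derivative2 \<tau> y u v + \<Gamma>' c' (\<tau> y) (derivative1 \<tau> y u) (derivative1 \<tau> y v))"

definition is_connection :: "('x, 'e::real_normed_vector) manifold \<Rightarrow> ('x, 'e) connection \<Rightarrow> bool" where
  "is_connection M \<Gamma> \<longleftrightarrow>
     (\<forall>c\<in>atlas M. (\<forall>y\<in>snd c ` fst c. bilinear (\<Gamma> c y)) \<and>
                  (\<forall>u v. smooth_on (\<lambda>y. \<Gamma> c y u v) (snd c ` fst c))) \<and>
     carries_connection M \<Gamma> M \<Gamma> id"

definition torsion_free :: "('x, 'e::real_normed_vector) manifold \<Rightarrow> ('x, 'e) connection \<Rightarrow> bool" where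
  "torsion_free M \<Gamma> \<longleftrightarrow> (\<forall>c\<in>atlas M. \<forall>y\<in>snd c ` fst c. \<forall>u v. \<Gamma> c y u v = \<Gamma> c y v u)"

definition curvature :: "('x, 'e::real_normed_vector) connection \<Rightarrow> ('x, 'e) chart \<Rightarrow> 'e \<Rightarrow> 'e \<Rightarrow> 'e \<Rightarrow> 'e \<Rightarrow> 'e" where
  "curvature \<Gamma> c y u v w =
     derivative1 (\<lambda>z. \<Gamma> c z v w) y u - derivative1 (\<lambda>z. \<Gamma> c z u w) y v
     + \<Gamma> c y u (\<Gamma> c y v w) - \<Gamma> c y v (\<Gamma> c y u w)"

definition flat :: "('x, 'e::real_normed_vector) manifold \<Rightarrow> ('x, 'e) connection \<Rightarrow> bool" where
  "flat M \<Gamma> \<longleftrightarrow> (\<forall>c\<in>atlas M. \<forall>y\<in>snd c ` fst c. \<forall>u v w. curvature \<Gamma> c y u v w = 0)"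

definition affine_manifold :: "('x, 'e::real_normed_vector) manifold \<Rightarrow> ('x, 'e) connection \<Rightarrow> bool" where
  "affine_manifold M \<Gamma> \<longleftrightarrow> smooth_manifold M \<and> is_connection M \<Gamma> \<and> torsion_free M \<Gamma> \<and> flat M \<Gamma>"

definition affinely_isomorphic ::
  "('x, 'e::real_normed_vector) manifold \<Rightarrow> ('x, 'e) connection \<Rightarrow>
   ('y, 'f::real_normed_vector) manifold \<Rightarrow> ('y, 'f) connection \<Rightarrow> bool" where
  "affinely_isomorphic M \<Gamma> N \<Gamma>' \<longleftrightarrow>
     affine_manifold M \<Gamma> \<and> affine_manifold N \<Gamma>' \<and>
     (\<exists>f. diffeomorphism M N f \<and> carries_connection M \<Gamma> N \<Gamma>' f)"

text \<open>The connection whose Christoffel symbols vanish in all charts of the given atlas; it is well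
  defined when the transition maps of that atlas are affine.\<close>

definition standard_connection :: "('x, 'e::real_normed_vector) connection" where
  "standard_connection = (\<lambda>c y u v. 0)"

text \<open>Affine coordinates: a chart of the maximal smooth atlas, not necessarily in \<open>atlas M\<close>, in which
  the Christoffel symbols vanish.\<close>

definition affine_coordinates ::
  "('x, 'e::real_normed_vector) manifold \<Rightarrow> ('x, 'e) connection \<Rightarrow> ('x, 'e) chart \<Rightarrow> bool" where
  "affine_coordinates M \<Gamma> c \<longleftrightarrow> is_chart (mtop M) c \<and>
     (\<forall>c'\<in>atlas M. smooth_on (local_rep c c' id) (local_dom c c' id) \<and>
                   smooth_on (local_rep c' c id) (local_dom c' c id)) \<and>
     carries_connection M \<Gamma> (M\<lparr>atlas := {c}\<rparr>) standard_connection id"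


section \<open>Hessian metrics and the dual connection\<close>

text \<open>\<open>g = f\<^sup>* g'\<close>\<close>

definition pulls_back_metric ::
  "('x, 'e::real_normed_vector) manifold \<Rightarrow> ('x, 'e) metric \<Rightarrow>
   ('y, 'f::real_normed_vector) manifold \<Rightarrow> ('y, 'f) metric \<Rightarrow> ('x \<Rightarrow> 'y) \<Rightarrow> bool" where
  "pulls_back_metric M g N g' f \<longleftrightarrow>
     (\<forall>c\<in>atlas M. \<forall>c'\<in>atlas N. \<forall>y\<in>local_dom c c' f. \<forall>u v.
        let \<tau> = local_rep c c' f in
        g c y u v = g' c' (\<tau> y) (derivative1 \<tau> y u) (derivative1 \<tau> y v))"

definition riemannian_metric :: "('x, 'e::real_normed_vector) manifold \<Rightarrow> ('x, 'e) metric \<Rightarrow> bool" where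
  "riemannian_metric M g \<longleftrightarrow>
     (\<forall>c\<in>atlas M. (\<forall>y\<in>snd c ` fst c. bilinear (g c y) \<and> (\<forall>u v. g c y u v = g c y v u) \<and>
                                     (\<forall>u. u \<noteq> 0 \<longrightarrow> g c y u u > 0)) \<and>
                  (\<forall>u v. smooth_on (\<lambda>y. g c y u v) (snd c ` fst c))) \<and>
     pulls_back_metric M g M g id"

definition hessian_metric ::
  "('x, 'e::real_normed_vector) manifold \<Rightarrow> ('x, 'e) connection \<Rightarrow> ('x, 'e) metric \<Rightarrow> bool" where
  "hessian_metric M \<Gamma> g \<longleftrightarrow> riemannian_metric M g \<and>
     (\<forall>x\<in>topspace (mtop M). \<exists>c \<phi>. affine_coordinates M \<Gamma> c \<and> x \<in> fst c \<and>
        smooth_on \<phi> (snd c ` fst c) \<and> convex_on (snd c ` fst c) \<phi> \<and>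
        pulls_back_metric M g (M\<lparr>atlas := {c}\<rparr>) (\<lambda>_. derivative2 \<phi>) id)"

definition hessian_manifold ::
  "('x, 'e::real_normed_vector) manifold \<Rightarrow> ('x, 'e) connection \<Rightarrow> ('x, 'e) metric \<Rightarrow> bool" where
  "hessian_manifold M \<Gamma> g \<longleftrightarrow> affine_manifold M \<Gamma> \<and> hessian_metric M \<Gamma> g"

definition levi_civita_connection ::
  "('x, 'e::real_normed_vector) manifold \<Rightarrow> ('x, 'e) metric \<Rightarrow> ('x, 'e) connection \<Rightarrow> bool" where
  "levi_civita_connection M g \<Gamma> \<longleftrightarrow> is_connection M \<Gamma> \<and> torsion_free M \<Gamma> \<and>
     (\<forall>c\<in>atlas M. \<forall>y\<in>snd c ` fst c. \<forall>u v w.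
        derivative1 (\<lambda>z. g c z v w) y u = g c y (\<Gamma> c y u v) w + g c y v (\<Gamma> c y u w))"

text \<open>\<open>\<nabla>' = 2\<nabla>\<^sub>g - \<nabla>\<close>, where \<open>\<Gamma>g\<close> is the Levi-Civita connection.\<close>

definition dual_connection ::
  "('x, 'e::real_normed_vector) connection \<Rightarrow> ('x, 'e) connection \<Rightarrow> ('x, 'e) connection" where
  "dual_connection \<Gamma>g \<Gamma> = (\<lambda>c y u v. 2 *\<^sub>R \<Gamma>g c y u v - \<Gamma> c y u v)"


section \<open>Group actions and quotients\<close>

definition affine_transformation :: "('a::real_vector \<Rightarrow> 'a) \<Rightarrow> bool" where
  "affine_transformation h \<longleftrightarrow> (\<exists>A b. linear A \<and> bij A \<and> h = (\<lambda>x. A x + b))"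

definition affine_transformation_group :: "('a::real_vector \<Rightarrow> 'a) set \<Rightarrow> bool" where
  "affine_transformation_group G \<longleftrightarrow> (\<forall>h\<in>G. affine_transformation h) \<and>
     id \<in> G \<and> (\<forall>h\<in>G. \<forall>k\<in>G. h \<circ> k \<in> G) \<and> (\<forall>h\<in>G. inv h \<in> G)"

text \<open>The action of \<open>h\<close> pushed forward along \<open>F\<close> from \<open>S\<close> to \<open>F ` S\<close>: if \<open>F\<close> is injective on \<open>S\<close>,
  then \<open>F m\<close> is sent to \<open>F (h m)\<close>.\<close>

definition pushed_action :: "'a set \<Rightarrow> ('a \<Rightarrow> 'b) \<Rightarrow> ('a \<Rightarrow> 'a) \<Rightarrow> 'b \<Rightarrow> 'b" where
  "pushed_action S F h = (\<lambda>\<xi>. F (h (inv_into S F \<xi>)))"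

definition orbit :: "('a \<Rightarrow> 'a) set \<Rightarrow> 'a \<Rightarrow> 'a set" where
  "orbit G x = (\<lambda>h. h x) ` G"

definition quotient_topology :: "'a topology \<Rightarrow> ('a \<Rightarrow> 'b) \<Rightarrow> 'b topology" where
  "quotient_topology T q =
     topology (\<lambda>U. U \<subseteq> q ` topspace T \<and> openin T {x \<in> topspace T. q x \<in> U})"

lemma openin_quotient_topology:
  "openin (quotient_topology T q) U \<longleftrightarrow>
     U \<subseteq> q ` topspace T \<and> openin T {x \<in> topspace T. q x \<in> U}"
proof -
  have "istopology (\<lambda>U. U \<subseteq> q ` topspace T \<and> openin T {x \<in> topspace T. q x \<in> U})"
    unfolding istopology_def
  proof (intro conjI allI impI)
    fix A B
    assume A: "A \<subseteq> q ` topspace T \<and> openin T {x \<in> topspace T. q x \<in> A}"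
      and B: "B \<subseteq> q ` topspace T \<and> openin T {x \<in> topspace T. q x \<in> B}"
    show "A \<inter> B \<subseteq> q ` topspace T" using A by blast
    have "{x \<in> topspace T. q x \<in> A \<inter> B} =
          {x \<in> topspace T. q x \<in> A} \<inter> {x \<in> topspace T. q x \<in> B}" by blast
    then show "openin T {x \<in> topspace T. q x \<in> A \<inter> B}"
      using A B by (simp only: openin_Int)
  next
    fix K
    assume K: "\<forall>A\<in>K. A \<subseteq> q ` topspace T \<and> openin T {x \<in> topspace T. q x \<in> A}"
    show "\<Union>K \<subseteq> q ` topspace T" using K by blast
    have "{x \<in> topspace T. q x \<in> \<Union>K} = (\<Union>A\<in>K. {x \<in> topspace T. q x \<in> A})" by blast
    then show "openin T {x \<in> topspace T. q x \<in> \<Union>K}"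
      using K by (metis (no_types, lifting) imageE openin_Union)
  qed
  then show ?thesis by (simp add: quotient_topology_def)
qed

lemma quotient_map_quotient_topology: "quotient_map T (quotient_topology T q) q"
proof -
  have "topspace (quotient_topology T q) = q ` topspace T"
  proof
    show "topspace (quotient_topology T q) \<subseteq> q ` topspace T"
      using openin_quotient_topology openin_topspace by metis
    have "{x \<in> topspace T. q x \<in> q ` topspace T} = topspace T" by blast
    then have "openin (quotient_topology T q) (q ` topspace T)"
      by (simp add: openin_quotient_topology)
    then show "q ` topspace T \<subseteq> topspace (quotient_topology T q)" by (rule openin_subset)
  qed
  then show ?thesis by (auto simp: quotient_map_def openin_quotient_topology)
qed

text \<open>The quotient of an open subset \<open>S\<close> of a vector space by \<open>G\<close>: its points are the orbits and its
  charts are the local inverses of the projection. With \<open>standard_connection\<close> this is the affine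
  structure inherited from the vector space.\<close>

definition quotient_manifold :: "'e::real_normed_vector set \<Rightarrow> ('e \<Rightarrow> 'e) set \<Rightarrow> ('e set, 'e) manifold" where
  "quotient_manifold S G =
     \<lparr>mtop = quotient_topology (top_of_set S) (orbit G),
      atlas = {(orbit G ` W, inv_into W (orbit G)) | W. open W \<and> W \<subseteq> S \<and> inj_on (orbit G) W}\<rparr>"

end

theory Submission
  imports Defs
begin

text \<open>Write \<open>F = \<partial>\<Phi>\<close> and \<open>P = p \<circ> F\<^sup>-\<^sup>1\<close>. Since the Hessian of \<open>\<Phi>\<close> is the positive definite \<open>p\<^sup>*g\<close>, \<open>F\<close> is a
  diffeomorphism onto an open set, \<open>P\<close> is a surjective local diffeomorphism, and its fibres are the
  orbits of the pushed action, so the quotient is homeomorphic to \<open>X\<close> through \<open>P\<close>. An element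
  \<open>h x = A x + a\<close> of \<open>G\<close> preserves the Hessian of \<open>\<Phi>\<close>; hence \<open>x \<mapsto> F (h x) - F x \<circ> A\<^sup>-\<^sup>1\<close> has zero
  derivative and the pushed action is affine. In a chart put \<open>\<sigma> = c \<circ> p\<close>. Differentiating
  \<open>D\<^sup>2\<Phi>(v, w) = g(D\<sigma> v, D\<sigma> w)\<close> and using that \<open>D\<^sup>3\<Phi>\<close> is symmetric gives
  \<open>D\<^sup>3\<Phi>(u, v, w) = 2 g((\<nabla>\<^sub>g - \<nabla>)(D\<sigma> u, D\<sigma> v), D\<sigma> w)\<close>. Since \<open>D\<^sup>2F\<close> is \<open>D\<^sup>3\<Phi>\<close>, this says that \<open>c \<circ> P\<close>
  satisfies \<open>D\<^sup>2\<tau>(u, v) + \<nabla>'(D\<tau> u, D\<tau> v) = 0\<close>: the dual connection pulls back to the standard one.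
  Differentiating this equation once more gives the flatness of \<open>\<nabla>'\<close>.\<close>

section \<open>\<open>C\<^sup>k\<close> maps\<close>

text \<open>Gradients live in the dual space, which is treated as a normed space only, whereas the
  chain rules and the inverse function argument expand vectors in a basis. So the dual space occurs
  as source or target of a composition, never in its middle: one passes from it through
  \<open>F_inv\<close> to \<open>real ^ 'n\<close> and on to X. Since the gradient image and the
  charts of X lie in different types, a local diffeomorphism is recorded by smooth local sections, a
  form that serves p and P alike and survives the change of variable F.

  The pushed action is meaningful on the gradient image alone, so the quotient is studied through
  the fibres of P and pointwise given affine maps, without the group law.

  The coefficients of the dual connection arise as follows. With k(u, v, w) for g((\<nabla>_g -
  \<nabla>)(u, v), w), compatibility with g gives k(u, v, w) + k(u, w, v) for the third derivative,
  and symmetry merges the summands into 2k. Passing from p to p o F^-1 adds the second derivative of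
  F^-1, which contributes -2(\<nabla>_g - \<nabla>); together with the term -\<nabla> already
  present for p this is -(2\<nabla>_g - \<nabla>).\<close>

lemma derivative1_eq: "derivative1 f x = frechet_derivative f (at x)"
  by (simp add: derivative1_def fun_eq_iff)

lemma derivative1_unique: "(f has_derivative f') (at x) \<Longrightarrow> derivative1 f x = f'"
  by (metis derivative1_eq frechet_derivative_at)

lemma derivative1_const [simp]: "derivative1 (\<lambda>_. c) x = (\<lambda>_. 0)"
  by (rule derivative1_unique) simp

text \<open>\<open>frechet_derivative\<close> chooses one of the derivatives at the point; functions
  that agree near the point have the same derivatives to choose from, so the equality holds also
  where neither is differentiable.\<close>

lemma derivative1_cong:
  assumes "open S" "x \<in> S" "\<And>y. y \<in> S \<Longrightarrow> f y = g y"
  shows "derivative1 f x = derivative1 g x"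
proof -
  have "(f has_derivative D) (at x) \<longleftrightarrow> (g has_derivative D) (at x)" for D
    using assms has_derivative_transform_within_open[of f D x UNIV S g]
      has_derivative_transform_within_open[of g D x UNIV S f] by auto
  then show ?thesis
    by (simp add: derivative1_eq frechet_derivative_def)
qed

lemma derivative2_cong:
  assumes "open S" "x \<in> S" "\<And>y. y \<in> S \<Longrightarrow> f y = g y"
  shows "derivative2 f x = derivative2 g x"
proof (intro ext)
  fix u v
  have "derivative1 (\<lambda>z. derivative1 f z v) x = derivative1 (\<lambda>z. derivative1 g z v) x"
    using assms by (intro derivative1_cong[of S]) (simp_all add: derivative1_cong[of S _ f g])
  then show "derivative2 f x u v = derivative2 g x u v"
    by (simp add: derivative2_def)
qed

lemma Ck_on_Suc:
  "Ck_on (Suc k) f S \<longleftrightarrow>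
    (\<forall>x\<in>S. f differentiable (at x)) \<and> (\<forall>v. Ck_on k (\<lambda>x. derivative1 f x v) S)"
  by (simp add: derivative1_eq)

lemma Ck_on_cong:
  assumes "open S" "\<And>x. x \<in> S \<Longrightarrow> f x = g x"
  shows "Ck_on k f S \<longleftrightarrow> Ck_on k g S"
  using assms(2)
proof (induction k arbitrary: f g)
  case 0
  then show ?case by (simp cong: continuous_on_cong)
next
  case (Suc k)
  have "f differentiable (at x) \<longleftrightarrow> g differentiable (at x)" if "x \<in> S" for x
    unfolding differentiable_def
    using Suc.prems that assms(1) has_derivative_transform_within_open[of f _ x UNIV S g]
      has_derivative_transform_within_open[of g _ x UNIV S f] by auto
  moreover have "Ck_on k (\<lambda>x. derivative1 f x v) S \<longleftrightarrow> Ck_on k (\<lambda>x. derivative1 g x v) S" for v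
    using Suc.prems by (intro Suc.IH) (simp add: derivative1_cong[OF assms(1), of _ f g])
  ultimately show ?case
    unfolding Ck_on_Suc by simp
qed

lemma Ck_on_subset: "Ck_on k f S \<Longrightarrow> T \<subseteq> S \<Longrightarrow> Ck_on k f T"
  by (induction k arbitrary: f) (auto intro: continuous_on_subset)

lemma Ck_on_imp_continuous_on: "Ck_on k f S \<Longrightarrow> continuous_on S f"
  by (cases k)
    (auto simp: continuous_on_eq_continuous_within
      intro: continuous_at_imp_continuous_within differentiable_imp_continuous_within)

lemma Ck_on_SucD: "Ck_on (Suc k) f S \<Longrightarrow> Ck_on k f S"
proof (induction k arbitrary: f)
  case 0
  then show ?case using Ck_on_imp_continuous_on by (simp del: Ck_on.simps(2)) blast
next
  case (Suc k)
  then show ?case by (metis Ck_on.simps(2))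
qed

lemma Ck_on_locally:
  assumes "\<And>x. x \<in> S \<Longrightarrow> \<exists>T. open T \<and> x \<in> T \<and> Ck_on k f T"
  shows "Ck_on k f S"
  using assms
proof (induction k arbitrary: f)
  case 0
  have "continuous (at x within S) f" if "x \<in> S" for x
  proof -
    obtain T where "open T" "x \<in> T" "continuous_on T f"
      using 0[OF \<open>x \<in> S\<close>] by (simp only: Ck_on.simps(1)) blast
    then have "continuous (at x) f"
      using continuous_on_eq_continuous_at by blast
    then show ?thesis
      by (rule continuous_at_imp_continuous_at_within)
  qed
  then show ?case
    by (simp add: continuous_on_eq_continuous_within)
next
  case (Suc k)
  have "f differentiable (at x)" if "x \<in> S" for x
    using Suc.prems[OF that] unfolding Ck_on_Suc by blast
  moreover have "Ck_on k (\<lambda>x. derivative1 f x v) S" for v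
  proof (rule Suc.IH)
    show "\<exists>T. open T \<and> x \<in> T \<and> Ck_on k (\<lambda>x. derivative1 f x v) T" if "x \<in> S" for x
      using Suc.prems[OF that] unfolding Ck_on_Suc by blast
  qed
  ultimately show ?case
    unfolding Ck_on_Suc by blast
qed


lemma Ck_on_Suc_has_derivative:
  "Ck_on (Suc k) f S \<Longrightarrow> x \<in> S \<Longrightarrow> (f has_derivative derivative1 f x) (at x)"
  by (simp add: derivative1_eq frechet_derivative_works)

lemma Ck_on_Suc_derivative1: "Ck_on (Suc k) f S \<Longrightarrow> Ck_on k (\<lambda>x. derivative1 f x v) S"
  by (simp add: derivative1_eq)

text \<open>\<open>Ck_on\<close> refers to the chosen derivative; with this rule an induction step
  may use whatever derivative a calculus rule produces.\<close>

lemma Ck_on_SucI: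
  assumes "open S" "\<And>x. x \<in> S \<Longrightarrow> (f has_derivative D x) (at x)"
    "\<And>v. Ck_on k (\<lambda>x. D x v) S"
  shows "Ck_on (Suc k) f S"
proof -
  have "Ck_on k (\<lambda>x. derivative1 f x v) S" for v
    using assms(3)[of v] derivative1_unique[OF assms(2)]
    by (subst Ck_on_cong[OF assms(1), where g = "\<lambda>x. D x v"]) auto
  then show ?thesis
    using assms(2) unfolding Ck_on_Suc differentiable_def by blast
qed

section \<open>Closure of C^k maps under algebraic operations and composition\<close>

lemma Ck_on_const: "Ck_on k (\<lambda>_. c) S"
  by (induction k arbitrary: c) simp_all

lemma Ck_on_linear_compose:
  assumes "bounded_linear L" "open S" "Ck_on k f S"
  shows "Ck_on k (\<lambda>x. L (f x)) S"
  using assms(3)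
proof (induction k arbitrary: f)
  case 0
  then show ?case using assms(1) by (simp add: bounded_linear.continuous_on)
next
  case (Suc k)
  show ?case
    by (rule Ck_on_SucI[OF assms(2), where D = "\<lambda>x v. L (derivative1 f x v)"])
      (auto intro!: Suc.IH bounded_linear.has_derivative[OF assms(1)]
        Ck_on_Suc_has_derivative[OF Suc.prems] Ck_on_Suc_derivative1[OF Suc.prems])
qed

lemma Ck_on_add:
  assumes "open S" "Ck_on k f S" "Ck_on k g S"
  shows "Ck_on k (\<lambda>x. f x + g x) S"
  using assms(2,3)
proof (induction k arbitrary: f g)
  case 0
  then show ?case by (simp add: continuous_on_add)
next
  case (Suc k)
  show ?case
    by (rule Ck_on_SucI[OF assms(1), where D = "\<lambda>x v. derivative1 f x v + derivative1 g x v"])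
      (auto intro!: Suc.IH has_derivative_add Ck_on_Suc_has_derivative Ck_on_Suc_derivative1 Suc.prems)
qed

lemma Ck_on_sum:
  assumes "open S" "\<And>i. i \<in> I \<Longrightarrow> Ck_on k (f i) S"
  shows "Ck_on k (\<lambda>x. \<Sum>i\<in>I. f i x) S"
  using assms(2) by (induction I rule: infinite_finite_induct) (auto intro: Ck_on_const Ck_on_add[OF assms(1)])

text \<open>The product rule returns a sum of terms of the same shape B(f, g) with one factor
  differentiated; hence the induction runs over all f and g at once.\<close>

lemma Ck_on_bilinear:
  assumes "bounded_bilinear B" "open S" "Ck_on k f S" "Ck_on k g S"
  shows "Ck_on k (\<lambda>x. B (f x) (g x)) S"
  using assms(3,4)
proof (induction k arbitrary: f g)
  case 0
  then show ?case by (simp add: bounded_bilinear.continuous_on[OF assms(1)])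
next
  case (Suc k)
  note D = Ck_on_Suc_has_derivative[OF Suc.prems(1)] Ck_on_Suc_has_derivative[OF Suc.prems(2)]
  show ?case
  proof (rule Ck_on_SucI[OF assms(2)])
    show "((\<lambda>x. B (f x) (g x)) has_derivative
        (\<lambda>v. B (f x) (derivative1 g x v) + B (derivative1 f x v) (g x))) (at x)" if "x \<in> S" for x
      by (rule bounded_bilinear.FDERIV[OF assms(1) D[OF that]])
    show "Ck_on k (\<lambda>x. B (f x) (derivative1 g x v) + B (derivative1 f x v) (g x)) S" for v
      by (intro Ck_on_add[OF assms(2)] Suc.IH Ck_on_Suc_derivative1[OF Suc.prems(1)]
        Ck_on_Suc_derivative1[OF Suc.prems(2)] Ck_on_SucD[OF Suc.prems(1)] Ck_on_SucD[OF Suc.prems(2)])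
  qed
qed

lemma Ck_on_prod:
  fixes f :: "'i \<Rightarrow> 'a::real_normed_vector \<Rightarrow> real"
  assumes "open S" "\<And>i. i \<in> I \<Longrightarrow> Ck_on k (f i) S"
  shows "Ck_on k (\<lambda>x. \<Prod>i\<in>I. f i x) S"
  using assms(2)
  by (induction I rule: infinite_finite_induct)
    (auto intro: Ck_on_const Ck_on_bilinear[OF bounded_bilinear_mult assms(1)])

text \<open>(1/f)' = - (1/f) f' (1/f) involves f' and again 1/f, to which the induction hypothesis
  applies one order lower.\<close>

lemma Ck_on_inverse:
  fixes f :: "'a::real_normed_vector \<Rightarrow> real"
  assumes "open S" "Ck_on k f S" "\<And>x. x \<in> S \<Longrightarrow> f x \<noteq> 0"
  shows "Ck_on k (\<lambda>x. inverse (f x)) S"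
  using assms(2)
proof (induction k)
  case 0
  then show ?case using assms(3) by (simp add: continuous_on_inverse)
next
  case (Suc k)
  note mult = Ck_on_bilinear[OF bounded_bilinear_mult assms(1)]
  have "Ck_on k (\<lambda>x. - 1 * (inverse (f x) * derivative1 f x v * inverse (f x))) S" for v
    by (intro mult Ck_on_const Suc.IH Ck_on_Suc_derivative1[OF Suc.prems] Ck_on_SucD[OF Suc.prems])
  then show ?case
    by (intro Ck_on_SucI[OF assms(1), where
          D = "\<lambda>x v. - (inverse (f x) * derivative1 f x v * inverse (f x))"])
      (auto intro!: Deriv.has_derivative_inverse assms(3) Ck_on_Suc_has_derivative[OF Suc.prems] simp del: Ck_on.simps)
qed

lemma linear_Basis_expansion:
  fixes L :: "'a::euclidean_space \<Rightarrow> 'b::real_vector"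
  assumes "linear L"
  shows "L v = (\<Sum>b\<in>Basis. (v \<bullet> b) *\<^sub>R L b)"
  by (metis (no_types, lifting) assms euclidean_representation linear_scale linear_sum sum.cong)

text \<open>In D(f o g)(x) v = Df(g x)(Dg(x) v) the direction in which f is differentiated moves
  with x, while \<open>Ck_on\<close> knows fixed directions only. Expanding Dg(x) v in the basis of
  the middle space separates the two; this is why that space is euclidean.\<close>

lemma Ck_on_compose:
  fixes g :: "'a::real_normed_vector \<Rightarrow> 'b::euclidean_space"
    and f :: "'b \<Rightarrow> 'c::real_normed_vector"
  assumes "open S" "open T" "g ` S \<subseteq> T" "Ck_on k f T" "Ck_on k g S"
  shows "Ck_on k (\<lambda>x. f (g x)) S"
  using assms(4,5)
proof (induction k arbitrary: f)
  case 0
  then show ?case using continuous_on_compose2[OF _ _ assms(3)] by simp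
next
  case (Suc k)
  have lin: "linear (derivative1 f y)" if "y \<in> T" for y
    using Ck_on_Suc_has_derivative[OF Suc.prems(1) that] has_derivative_linear by blast
  show ?case
  proof (rule Ck_on_SucI[OF assms(1), where D = "\<lambda>x v. \<Sum>b\<in>Basis. (derivative1 g x v \<bullet> b) *\<^sub>R derivative1 f (g x) b"])
    fix x assume x: "x \<in> S"
    then have gx: "g x \<in> T" using assms(3) by auto
    have "((\<lambda>x. f (g x)) has_derivative (\<lambda>v. derivative1 f (g x) (derivative1 g x v))) (at x)"
      using Ck_on_Suc_has_derivative[OF Suc.prems(1) gx] Ck_on_Suc_has_derivative[OF Suc.prems(2) x]
      by (rule has_derivative_compose[rotated])
    then show "((\<lambda>x. f (g x)) has_derivative
        (\<lambda>v. \<Sum>b\<in>Basis. (derivative1 g x v \<bullet> b) *\<^sub>R derivative1 f (g x) b)) (at x)"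
      using linear_Basis_expansion[OF lin[OF gx]] by (metis (no_types, lifting) ext)
  next
    fix v
    show "Ck_on k (\<lambda>x. \<Sum>b\<in>Basis. (derivative1 g x v \<bullet> b) *\<^sub>R derivative1 f (g x) b) S"
      by (intro Ck_on_sum Ck_on_bilinear[OF bounded_bilinear_scaleR] assms(1) Suc.IH
        Ck_on_linear_compose[OF bounded_linear_inner_left] Ck_on_Suc_derivative1[OF Suc.prems(1)]
        Ck_on_Suc_derivative1[OF Suc.prems(2)] Ck_on_SucD[OF Suc.prems(2)])
  qed
qed

lemma Ck_on_vec:
  fixes f :: "'a::real_normed_vector \<Rightarrow> real ^ 'n"
  assumes "open S" "\<And>i. Ck_on k (\<lambda>x. f x $ i) S"
  shows "Ck_on k f S"
proof -
  have "Ck_on k (\<lambda>x. \<Sum>i\<in>UNIV. f x $ i *\<^sub>R axis i (1::real)) S"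
    using assms by (intro Ck_on_sum Ck_on_bilinear[OF bounded_bilinear_scaleR] Ck_on_const)
  moreover have "(\<lambda>x. \<Sum>i\<in>UNIV. f x $ i *\<^sub>R axis i 1) = f"
    by (simp add: fun_eq_iff vec_eq_iff axis_def if_distrib[of "\<lambda>t. _ * t"] cong: if_cong)
  ultimately show ?thesis by (simp only:)
qed

section \<open>Smooth maps\<close>

text \<open>A recursion equation that lets smoothness be handled without mentioning orders: order k
  + 1 implies order k, so all orders and all successor orders amount to the same.\<close>

lemma smooth_on_Suc:
  "smooth_on f S \<longleftrightarrow> (\<forall>x\<in>S. (f has_derivative derivative1 f x) (at x)) \<and> (\<forall>v. smooth_on (\<lambda>x. derivative1 f x v) S)"
proof -
  have "smooth_on f S \<longleftrightarrow> (\<forall>k. Ck_on (Suc k) f S)"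
    unfolding smooth_on_def using Ck_on_SucD by blast
  then show ?thesis
    unfolding Ck_on_Suc smooth_on_def by (auto simp: derivative1_eq frechet_derivative_works)
qed

lemma smooth_on_has_derivative: "smooth_on f S \<Longrightarrow> x \<in> S \<Longrightarrow> (f has_derivative derivative1 f x) (at x)"
  using smooth_on_Suc by blast

lemma smooth_on_linear: "smooth_on f S \<Longrightarrow> x \<in> S \<Longrightarrow> linear (derivative1 f x)"
  using smooth_on_has_derivative has_derivative_linear by blast

lemma smooth_on_derivative1: "smooth_on f S \<Longrightarrow> smooth_on (\<lambda>x. derivative1 f x v) S"
  using smooth_on_Suc by blast

lemma smooth_on_has_derivative2:
  "smooth_on f S \<Longrightarrow> x \<in> S \<Longrightarrow> ((\<lambda>z. derivative1 f z v) has_derivative (\<lambda>u. derivative2 f x u v)) (at x)"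
  using smooth_on_has_derivative[OF smooth_on_derivative1] by (simp add: derivative2_def)

lemma smooth_on_cong: "open S \<Longrightarrow> (\<And>x. x \<in> S \<Longrightarrow> f x = g x) \<Longrightarrow> smooth_on f S \<longleftrightarrow> smooth_on g S"
  unfolding smooth_on_def using Ck_on_cong by metis

lemma smooth_on_eqI: "smooth_on g S \<Longrightarrow> open S \<Longrightarrow> (\<And>x. x \<in> S \<Longrightarrow> f x = g x) \<Longrightarrow> smooth_on f S"
  using smooth_on_cong by blast

lemma smooth_on_subset: "smooth_on f S \<Longrightarrow> T \<subseteq> S \<Longrightarrow> smooth_on f T"
  unfolding smooth_on_def using Ck_on_subset by blast

lemma smooth_on_continuous: "smooth_on f S \<Longrightarrow> continuous_on S f"
  unfolding smooth_on_def using Ck_on.simps(1) by blast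

text \<open>Transition maps of the quotient are given by a formula that changes from point to point,
  so their smoothness is first available near each point.\<close>

lemma smooth_on_locally:
  assumes "\<And>x. x \<in> S \<Longrightarrow> \<exists>T. open T \<and> x \<in> T \<and> smooth_on f T"
  shows "smooth_on f S"
  unfolding smooth_on_def
proof
  fix k
  show "Ck_on k f S"
    by (rule Ck_on_locally) (use assms in \<open>unfold smooth_on_def, blast\<close>)
qed

lemma smooth_on_const: "smooth_on (\<lambda>_. c) S"
  by (simp add: smooth_on_def Ck_on_const)

lemma smooth_on_linear_compose:
  "bounded_linear L \<Longrightarrow> open S \<Longrightarrow> smooth_on f S \<Longrightarrow> smooth_on (\<lambda>x. L (f x)) S"
  by (simp add: smooth_on_def Ck_on_linear_compose)

lemma smooth_on_add: "open S \<Longrightarrow> smooth_on f S \<Longrightarrow> smooth_on g S \<Longrightarrow> smooth_on (\<lambda>x. f x + g x) S"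
  by (simp add: smooth_on_def Ck_on_add)

lemma smooth_on_sum:
  "open S \<Longrightarrow> (\<And>i. i \<in> I \<Longrightarrow> smooth_on (f i) S) \<Longrightarrow> smooth_on (\<lambda>x. \<Sum>i\<in>I. f i x) S"
  by (simp add: smooth_on_def Ck_on_sum)

lemma smooth_on_scaleR:
  "open S \<Longrightarrow> smooth_on f S \<Longrightarrow> smooth_on g S \<Longrightarrow> smooth_on (\<lambda>x. f x *\<^sub>R g x) S"
  by (simp add: smooth_on_def Ck_on_bilinear[OF bounded_bilinear_scaleR])

lemma smooth_on_compose:
  fixes g :: "'a::real_normed_vector \<Rightarrow> 'b::euclidean_space"
  shows "open S \<Longrightarrow> open T \<Longrightarrow> g ` S \<subseteq> T \<Longrightarrow> smooth_on f T \<Longrightarrow> smooth_on g S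
    \<Longrightarrow> smooth_on (\<lambda>x. f (g x)) S"
  unfolding smooth_on_def using Ck_on_compose by blast

lemma smooth_on_affine:
  assumes "bounded_linear L"
  shows "smooth_on (\<lambda>x. L x + c) S"
proof -
  have D: "((\<lambda>x. L x + c) has_derivative L) (at x)" for x
    using bounded_linear.has_derivative[OF assms has_derivative_ident]
    by (auto intro!: derivative_eq_intros)
  have "derivative1 (\<lambda>x. L x + c) x = L" for x
    by (rule derivative1_unique[OF D])
  with D show ?thesis
    by (subst smooth_on_Suc) (simp add: smooth_on_const)
qed

lemma derivative2_affine:
  assumes "bounded_linear L"
  shows "derivative2 (\<lambda>x. L x + c) x u v = 0"
proof -
  have "((\<lambda>x. L x + c) has_derivative L) (at x)" for x
    using bounded_linear.has_derivative[OF assms has_derivative_ident]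
    by (auto intro!: derivative_eq_intros)
  then have "derivative1 (\<lambda>x. L x + c) x = L" for x
    by (rule derivative1_unique)
  then show ?thesis by (simp add: derivative2_def)
qed


section \<open>Chain rule and symmetry of the second derivative\<close>

lemma linear_Basis_expansion2:
  fixes B :: "'a::euclidean_space \<Rightarrow> 'b::euclidean_space \<Rightarrow> 'c::real_vector"
  assumes "bilinear B"
  shows "B a b = (\<Sum>i\<in>Basis. \<Sum>j\<in>Basis. ((a \<bullet> i) * (b \<bullet> j)) *\<^sub>R B i j)"
proof -
  have "B a b = (\<Sum>i\<in>Basis. (a \<bullet> i) *\<^sub>R B i b)"
    using assms by (intro linear_Basis_expansion) (simp add: bilinear_def)
  also have "\<dots> = (\<Sum>i\<in>Basis. (a \<bullet> i) *\<^sub>R (\<Sum>j\<in>Basis. (b \<bullet> j) *\<^sub>R B i j))"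
    using assms by (intro sum.cong refl arg_cong[where f = "scaleR _"] linear_Basis_expansion)
      (simp add: bilinear_def)
  finally show ?thesis by (simp add: scaleR_sum_right)
qed

text \<open>The Leibniz rule for an expression with three moving slots, such as \<Gamma>(D\<tau> a,
  D\<tau> b) or g(D\<sigma> v, D\<sigma> w) at a moving point. Differentiability of \<beta> is
  assumed for constant arguments only; expansion in bases turns the expression into a finite sum of
  products of coordinates with such values.\<close>

lemma has_derivative_bilinear_family:
  fixes \<beta> :: "'b::real_normed_vector \<Rightarrow> 'c::euclidean_space \<Rightarrow> 'd::euclidean_space \<Rightarrow> 'e::real_normed_vector"
    and \<tau> :: "'a::real_normed_vector \<Rightarrow> 'b"
  assumes T: "open T" "\<tau> x \<in> T" "\<And>z. z \<in> T \<Longrightarrow> bilinear (\<beta> z)"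
    and \<beta>: "\<And>a b. ((\<lambda>z. \<beta> z a b) has_derivative \<beta>' a b) (at (\<tau> x))"
    and \<tau>: "(\<tau> has_derivative \<tau>') (at x)"
    and A: "(A has_derivative A') (at x)" and B: "(B has_derivative B') (at x)"
  shows "((\<lambda>y. \<beta> (\<tau> y) (A y) (B y)) has_derivative
    (\<lambda>w. \<beta>' (A x) (B x) (\<tau>' w) + \<beta> (\<tau> x) (A' w) (B x) + \<beta> (\<tau> x) (A x) (B' w))) (at x)"
    (is "(?f has_derivative ?f') _")
proof -
  have exp\<beta>: "\<beta> z a b = (\<Sum>i\<in>Basis. \<Sum>j\<in>Basis. ((a \<bullet> i) * (b \<bullet> j)) *\<^sub>R \<beta> z i j)" if "z \<in> T" for z a b
    using T(3)[OF that] by (rule linear_Basis_expansion2)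
  \<comment> \<open>Bilinearity of \<beta>' in its first two arguments is inherited from \<beta> by
    uniqueness of derivatives.\<close>
  have exp\<beta>': "\<beta>' a b w = (\<Sum>i\<in>Basis. \<Sum>j\<in>Basis. ((a \<bullet> i) * (b \<bullet> j)) *\<^sub>R \<beta>' i j w)" for a b w
  proof -
    have "((\<lambda>z. \<Sum>i\<in>Basis. \<Sum>j\<in>Basis. ((a \<bullet> i) * (b \<bullet> j)) *\<^sub>R \<beta> z i j) has_derivative
        (\<lambda>w. \<Sum>i\<in>Basis. \<Sum>j\<in>Basis. ((a \<bullet> i) * (b \<bullet> j)) *\<^sub>R \<beta>' i j w)) (at (\<tau> x))"
      by (intro has_derivative_sum has_derivative_scaleR_right \<beta>)
    then have "((\<lambda>z. \<beta> z a b) has_derivative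
        (\<lambda>w. \<Sum>i\<in>Basis. \<Sum>j\<in>Basis. ((a \<bullet> i) * (b \<bullet> j)) *\<^sub>R \<beta>' i j w)) (at (\<tau> x))"
      by (rule has_derivative_transform_within_open[OF _ T(1,2)]) (rule exp\<beta>[symmetric])
    from has_derivative_unique[OF \<beta> this] show ?thesis by metis
  qed
  let ?g = "\<lambda>y. \<Sum>i\<in>Basis. \<Sum>j\<in>Basis. ((A y \<bullet> i) * (B y \<bullet> j)) *\<^sub>R \<beta> (\<tau> y) i j"
  let ?g' = "\<lambda>w. \<Sum>i\<in>Basis. \<Sum>j\<in>Basis. ((A x \<bullet> i) * (B x \<bullet> j)) *\<^sub>R \<beta>' i j (\<tau>' w)
    + ((A x \<bullet> i) * (B' w \<bullet> j) + (A' w \<bullet> i) * (B x \<bullet> j)) *\<^sub>R \<beta> (\<tau> x) i j"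
  have g: "(?g has_derivative ?g') (at x)"
    by (intro has_derivative_sum has_derivative_scaleR has_derivative_mult has_derivative_inner_left A B
        has_derivative_compose[OF \<tau> \<beta>])
  have "?g' = ?f'"
    by (simp add: fun_eq_iff exp\<beta>[OF T(2), of "A x"] exp\<beta>[OF T(2), of "A' _"]
        exp\<beta>'[of "A x"] scaleR_add_left sum.distrib)
  moreover obtain U where U: "open U" "x \<in> U" "\<And>y. y \<in> U \<Longrightarrow> \<tau> y \<in> T"
  proof -
    have "continuous (at x) \<tau>"
      using \<tau> has_derivative_continuous by blast
    then show ?thesis
      using T(1,2) that unfolding continuous_at_open by blast
  qed
  ultimately show ?thesis
    using has_derivative_transform_within_open[OF g U(1,2), of ?f] exp\<beta>[OF U(3)] by simp
qed

lemma derivative1_compose: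
  assumes "smooth_on f T" "smooth_on g S" "g x \<in> T" "x \<in> S"
  shows "derivative1 (\<lambda>z. f (g z)) x = (\<lambda>u. derivative1 f (g x) (derivative1 g x u))"
  by (rule derivative1_unique, rule has_derivative_compose)
    (use assms in \<open>auto intro: smooth_on_has_derivative\<close>)

lemma derivative2_compose:
  fixes g :: "'a::real_normed_vector \<Rightarrow> 'b::euclidean_space"
  assumes ST: "open S" "open T" "g ` S \<subseteq> T" and f: "smooth_on f T" and g: "smooth_on g S" and x: "x \<in> S"
  shows "derivative2 (\<lambda>z. f (g z)) x u v =
    derivative2 f (g x) (derivative1 g x u) (derivative1 g x v) + derivative1 f (g x) (derivative2 g x u v)"
proof -
  \<comment> \<open>The linear map Df(z) is fitted into the bilinear rule by a dummy scalar factor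
    r, constantly 1 and so with derivative 0.\<close>
  let ?\<beta> = "\<lambda>z a (r::real). r *\<^sub>R derivative1 f z a"
  have gx: "g x \<in> T" using ST x by auto
  have bil: "bilinear (?\<beta> z)" if "z \<in> T" for z
    using smooth_on_linear[OF f that]
    by (auto simp: bilinear_def linear_iff algebra_simps)
  have "((\<lambda>y. ?\<beta> (g y) (derivative1 g y v) 1) has_derivative
      (\<lambda>w. 1 *\<^sub>R derivative2 f (g x) (derivative1 g x w) (derivative1 g x v)
        + ?\<beta> (g x) (derivative2 g x w v) 1 + ?\<beta> (g x) (derivative1 g x v) 0)) (at x)"
  proof (rule has_derivative_bilinear_family[where A = "\<lambda>y. derivative1 g y v" and B = "\<lambda>_. 1"
        and T = T and \<beta>' = "\<lambda>a r w. r *\<^sub>R derivative2 f (g x) w a"])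
    show "((\<lambda>z. r *\<^sub>R derivative1 f z a) has_derivative (\<lambda>w. r *\<^sub>R derivative2 f (g x) w a)) (at (g x))" for a r
      by (intro has_derivative_scaleR_right smooth_on_has_derivative2[OF f gx])
  qed (fact ST(2) gx bil smooth_on_has_derivative[OF g x] smooth_on_has_derivative2[OF g x] has_derivative_const)+
  then have "((\<lambda>y. derivative1 f (g y) (derivative1 g y v)) has_derivative
      (\<lambda>w. derivative2 f (g x) (derivative1 g x w) (derivative1 g x v)
        + derivative1 f (g x) (derivative2 g x w v))) (at x)"
    by simp
  then have "((\<lambda>y. derivative1 (\<lambda>z. f (g z)) y v) has_derivative
      (\<lambda>w. derivative2 f (g x) (derivative1 g x w) (derivative1 g x v)
        + derivative1 f (g x) (derivative2 g x w v))) (at x)"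
    by (rule has_derivative_transform_within_open[OF _ ST(1) x])
      (use ST f g in \<open>auto simp: derivative1_compose[of f T g S]\<close>)
  then show ?thesis
    unfolding derivative2_def[of "\<lambda>z. f (g z)"] by (simp add: derivative1_unique)
qed

section \<open>Symmetry of the second derivative by second differences\<close>

lemma smooth_on_line_derivative:
  assumes "smooth_on f S" "p + t *\<^sub>R u \<in> S"
  shows "((\<lambda>t. f (p + t *\<^sub>R u)) has_vector_derivative derivative1 f (p + t *\<^sub>R u) u) (at t)"
proof -
  have "((\<lambda>t. p + t *\<^sub>R u) has_derivative (\<lambda>h. h *\<^sub>R u)) (at t)"
    by (auto intro!: derivative_eq_intros)
  from has_derivative_compose[OF this smooth_on_has_derivative[OF assms]]
  show ?thesis
    using linear_scale[OF smooth_on_linear[OF assms]] by (simp add: has_vector_derivative_def)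
qed

text \<open>The mean value theorem applied twice: along u to the difference of f on the two sides
  parallel to u of the parallelogram, then along v to the directional derivative of f along u. The
  left-hand side is symmetric in u and v, and this symmetry is what gets exploited.\<close>

lemma second_difference_eq_derivative2:
  fixes f :: "'a::real_normed_vector \<Rightarrow> real"
  assumes f: "smooth_on f S" and s: "s > 0"
    and S: "\<And>a b. \<lbrakk>0 \<le> a; a \<le> s; 0 \<le> b; b \<le> s\<rbrakk> \<Longrightarrow> x + a *\<^sub>R u + b *\<^sub>R v \<in> S"
  shows "\<exists>a b. 0 \<le> a \<and> a \<le> s \<and> 0 \<le> b \<and> b \<le> s \<and>
    f (x + s *\<^sub>R u + s *\<^sub>R v) - f (x + s *\<^sub>R u) - f (x + s *\<^sub>R v) + f x = s * s * derivative2 f (x + a *\<^sub>R u + b *\<^sub>R v) v u"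
proof -
  note vec = has_real_derivative_iff_has_vector_derivative
  have D: "((\<lambda>a. f (x + b *\<^sub>R v + a *\<^sub>R u)) has_real_derivative derivative1 f (x + b *\<^sub>R v + a *\<^sub>R u) u) (at a)"
    if "0 \<le> a" "a \<le> s" "0 \<le> b" "b \<le> s" for a b
    unfolding vec using S[OF that] by (intro smooth_on_line_derivative[OF f]) (simp add: algebra_simps)
  have "((\<lambda>a. f (x + s *\<^sub>R v + a *\<^sub>R u) - f (x + 0 *\<^sub>R v + a *\<^sub>R u)) has_real_derivative
      derivative1 f (x + s *\<^sub>R v + a *\<^sub>R u) u - derivative1 f (x + 0 *\<^sub>R v + a *\<^sub>R u) u) (at a)"
    if "0 \<le> a" "a \<le> s" for a
    using that s by (intro DERIV_diff D) auto
  from MVT2[OF s this] obtain a where a: "0 < a" "a < s" and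
    1: "f (x + s *\<^sub>R v + s *\<^sub>R u) - f (x + 0 *\<^sub>R v + s *\<^sub>R u) - (f (x + s *\<^sub>R v + 0 *\<^sub>R u) - f (x + 0 *\<^sub>R v + 0 *\<^sub>R u))
      = (s - 0) * (derivative1 f (x + s *\<^sub>R v + a *\<^sub>R u) u - derivative1 f (x + 0 *\<^sub>R v + a *\<^sub>R u) u)"
    by blast
  have "((\<lambda>b. derivative1 f (x + a *\<^sub>R u + b *\<^sub>R v) u) has_real_derivative derivative2 f (x + a *\<^sub>R u + b *\<^sub>R v) v u) (at b)"
    if "0 \<le> b" "b \<le> s" for b
    unfolding vec derivative2_def using S[of a b] that a
    by (intro smooth_on_line_derivative[OF smooth_on_derivative1[OF f]]) simp
  from MVT2[OF s this] obtain b where b: "0 < b" "b < s" and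
    2: "derivative1 f (x + a *\<^sub>R u + s *\<^sub>R v) u - derivative1 f (x + a *\<^sub>R u + 0 *\<^sub>R v) u
      = (s - 0) * derivative2 f (x + a *\<^sub>R u + b *\<^sub>R v) v u"
    by blast
  from 1 2 have "f (x + s *\<^sub>R u + s *\<^sub>R v) - f (x + s *\<^sub>R u) - f (x + s *\<^sub>R v) + f x
      = s * s * derivative2 f (x + a *\<^sub>R u + b *\<^sub>R v) v u"
    by (simp add: add_ac)
  with a b show ?thesis by (metis less_imp_le)
qed

text \<open>One inequality suffices, as u and v may be exchanged. If it failed, a number m would
  separate the two continuous functions on a whole ball, yet the second difference of a small
  parallelogram in that ball is s * s times a value of either.\<close>

lemma derivative2_commute_real:
  fixes f :: "'a::real_normed_vector \<Rightarrow> real"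
  assumes S: "open S" and f: "smooth_on f S" and x: "x \<in> S"
  shows "derivative2 f x u v \<le> derivative2 f x v u"
proof (rule ccontr)
  assume "\<not> derivative2 f x u v \<le> derivative2 f x v u"
  then obtain m where m: "derivative2 f x v u < m" "m < derivative2 f x u v"
    using dense[of "derivative2 f x v u" "derivative2 f x u v"] by auto
  have cont: "continuous_on S (\<lambda>y. derivative2 f y a b)" for a b
    unfolding derivative2_def by (intro smooth_on_continuous smooth_on_derivative1 f)
  have "open ({y \<in> S. derivative2 f y v u < m} \<inter> {y \<in> S. m < derivative2 f y u v})"
    using continuous_open_preimage[OF cont[of v u] S, of "{..<m}"]
      continuous_open_preimage[OF cont[of u v] S, of "{m<..}"]
    by (intro open_Int) (simp_all add: vimage_def Int_def)
  then obtain d where d: "d > 0" and ball: "ball x d \<subseteq> {y \<in> S. derivative2 f y v u < m} \<inter> {y \<in> S. m < derivative2 f y u v}"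
    using m x open_contains_ball by blast
  \<comment> \<open>Small enough for the parallelogram with sides s u and s v to stay in the ball;
    the 1 keeps the denominator positive when u = v = 0 and makes the estimate strict.\<close>
  define s where "s = d / (norm u + norm v + 1)"
  have s: "s > 0" using d by (simp add: s_def add_nonneg_pos)
  have in_ball: "x + a *\<^sub>R u + b *\<^sub>R v \<in> ball x d" if "0 \<le> a" "a \<le> s" "0 \<le> b" "b \<le> s" for a b
  proof -
    have "norm (a *\<^sub>R u + b *\<^sub>R v) \<le> a * norm u + b * norm v"
      using norm_triangle_ineq[of "a *\<^sub>R u" "b *\<^sub>R v"] that by simp
    also have "\<dots> \<le> s * norm u + s * norm v"
      using that by (intro add_mono mult_right_mono) auto
    also have "\<dots> < s * (norm u + norm v + 1)" using s by (simp add: algebra_simps)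
    also have "\<dots> = d" by (simp add: s_def add_nonneg_eq_0_iff)
    finally have less: "norm (a *\<^sub>R u + b *\<^sub>R v) < d" .
    have eq: "x - (x + a *\<^sub>R u + b *\<^sub>R v) = - (a *\<^sub>R u + b *\<^sub>R v)" by simp
    show ?thesis
      unfolding mem_ball dist_norm eq norm_minus_cancel by (rule less)
  qed
  have in_ball': "x + a *\<^sub>R v + b *\<^sub>R u \<in> ball x d" if "0 \<le> a" "a \<le> s" "0 \<le> b" "b \<le> s" for a b
    using in_ball[of b a] that by (simp add: add_ac)
  obtain a b where 1: "x + a *\<^sub>R u + b *\<^sub>R v \<in> ball x d"
    "f (x + s *\<^sub>R u + s *\<^sub>R v) - f (x + s *\<^sub>R u) - f (x + s *\<^sub>R v) + f x = s * s * derivative2 f (x + a *\<^sub>R u + b *\<^sub>R v) v u"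
    using second_difference_eq_derivative2[OF f s, of x u v] in_ball ball by blast
  obtain a' b' where 2: "x + a' *\<^sub>R v + b' *\<^sub>R u \<in> ball x d"
    "f (x + s *\<^sub>R v + s *\<^sub>R u) - f (x + s *\<^sub>R v) - f (x + s *\<^sub>R u) + f x = s * s * derivative2 f (x + a' *\<^sub>R v + b' *\<^sub>R u) u v"
    using second_difference_eq_derivative2[OF f s, of x v u] in_ball' ball by blast
  have "s * s * derivative2 f (x + a *\<^sub>R u + b *\<^sub>R v) v u = s * s * derivative2 f (x + a' *\<^sub>R v + b' *\<^sub>R u) u v"
  proof -
    have "x + s *\<^sub>R v + s *\<^sub>R u = x + s *\<^sub>R u + s *\<^sub>R v" by simp
    from 1(2) 2(2)[unfolded this] show ?thesis by linarith
  qed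
  then have "derivative2 f (x + a *\<^sub>R u + b *\<^sub>R v) v u = derivative2 f (x + a' *\<^sub>R v + b' *\<^sub>R u) u v"
    using s by simp
  moreover have "derivative2 f (x + a *\<^sub>R u + b *\<^sub>R v) v u < m" "m < derivative2 f (x + a' *\<^sub>R v + b' *\<^sub>R u) u v"
    using ball 1(1) 2(1) by blast+
  ultimately show False by simp
qed

lemma derivative2_linear_compose:
  fixes f :: "'a::real_normed_vector \<Rightarrow> 'b::real_normed_vector"
  assumes L: "bounded_linear L" and S: "open S" and f: "smooth_on f S" and x: "x \<in> S"
  shows "derivative2 (\<lambda>z. L (f z)) x u v = L (derivative2 f x u v)"
proof -
  have D: "((\<lambda>z. L (h z)) has_derivative (\<lambda>u. L (derivative1 h x u))) (at x)"
    if "x \<in> S" "smooth_on h S" for h :: "'a \<Rightarrow> 'b" and x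
    by (intro bounded_linear.has_derivative[OF L] smooth_on_has_derivative[OF that(2,1)])
  have "derivative1 (\<lambda>z. derivative1 (\<lambda>z. L (f z)) z v) x = derivative1 (\<lambda>z. L (derivative1 f z v)) x"
    by (rule derivative1_cong[OF S x]) (simp add: derivative1_unique[OF D[OF _ f]])
  then show ?thesis
    unfolding derivative2_def by (simp add: derivative1_unique[OF D[OF x smooth_on_derivative1[OF f]]])
qed

lemma derivative2_commute:
  fixes f :: "'a::real_normed_vector \<Rightarrow> 'b::euclidean_space"
  assumes S: "open S" and f: "smooth_on f S" and x: "x \<in> S"
  shows "derivative2 f x u v = derivative2 f x v u"
proof (rule euclidean_eqI)
  fix b :: 'b
  have "smooth_on (\<lambda>z. f z \<bullet> b) S"
    by (rule smooth_on_linear_compose[OF bounded_linear_inner_left S f])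
  from derivative2_commute_real[OF S this x, of u v] derivative2_commute_real[OF S this x, of v u]
  show "derivative2 f x u v \<bullet> b = derivative2 f x v u \<bullet> b"
    by (simp add: derivative2_linear_compose[OF bounded_linear_inner_left S f x])
qed

section \<open>Smoothness of inverse maps\<close>

text \<open>Invariance of domain supplies the open image and the continuous inverse G; then DG(y) is
  the inverse of DF(G y). By Cramer's rule this inverse is a quotient of determinants, hence smooth
  in x = G y, and a bootstrap follows: if G is C^k, so is its derivative, and G is C^(k+1).\<close>

lemma smooth_on_inv_into:
  fixes F :: "real ^ 'n \<Rightarrow> real ^ 'n"
  assumes S: "open S" and F: "smooth_on F S" and inj: "inj_on F S"
    and ker: "\<And>x v. x \<in> S \<Longrightarrow> derivative1 F x v = 0 \<Longrightarrow> v = 0"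
  shows "open (F ` S)" "smooth_on (inv_into S F) (F ` S)"
proof -
  let ?G = "inv_into S F"
  let ?M = "\<lambda>x. matrix (derivative1 F x)"
  let ?N = "\<lambda>x v. \<chi> k. det (\<chi> i j. if j = k then v $ i else ?M x $ i $ j) * inverse (det (?M x))"
  have contF: "continuous_on S F"
    using F by (rule smooth_on_continuous)
  show oFS: "open (F ` S)"
    by (rule invariance_of_domain[OF contF S inj])
  obtain g where "homeomorphism S (F ` S) F g"
    using invariance_of_domain_homeomorphism[OF S contF _ inj] by auto
  then have "continuous_on (F ` S) g" "\<And>y. y \<in> F ` S \<Longrightarrow> ?G y = g y"
    using inj by (auto simp: homeomorphism_def)
  then have contG: "continuous_on (F ` S) ?G"
    by (simp cong: continuous_on_cong)
  have MF: "?M x *v v = derivative1 F x v" if "x \<in> S" for x v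
    using smooth_on_linear[OF F that] by (simp add: matrix_works)
  have det: "det (?M x) \<noteq> 0" if "x \<in> S" for x
    unfolding invertible_det_nz[symmetric] invertible_left_inverse matrix_left_invertible_ker
    using ker[OF that] by (simp add: MF[OF that])
  \<comment> \<open>Cramer's rule is an equivalence, so this one fact yields both inverse identities
    and the linearity of the inverse.\<close>
  have N: "?N x v = w \<longleftrightarrow> derivative1 F x w = v" if "x \<in> S" for x v w
    using cramer[OF det[OF that], of w v] MF[OF that] by (auto simp: divide_inverse)
  have NF: "?N x (derivative1 F x w) = w" if "x \<in> S" for x w
    using N[OF that] by blast
  have FN: "derivative1 F x (?N x v) = v" if "x \<in> S" for x v
    using N[OF that] by blast
  have linN: "linear (?N x)" if "x \<in> S" for x
  proof -
    note lin = smooth_on_linear[OF F that]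
    show ?thesis
    proof (rule linearI)
      show "?N x (a + b) = ?N x a + ?N x b" for a b
        unfolding N[OF that] linear_add[OF lin] FN[OF that] ..
      show "?N x (r *\<^sub>R a) = r *\<^sub>R ?N x a" for r a
        unfolding N[OF that] linear_scale[OF lin] FN[OF that] ..
    qed
  qed
  have "Ck_on k (\<lambda>x. ?N x v) S" for k v
  proof -
    have M: "Ck_on k (\<lambda>x. ?M x $ i $ j) S" for i j
    proof -
      have "Ck_on k (\<lambda>x. derivative1 F x (axis j 1)) S"
        using smooth_on_derivative1[OF F] by (simp add: smooth_on_def)
      from Ck_on_linear_compose[OF bounded_linear_vec_nth[of i] S this] show ?thesis
        by (simp add: matrix_def)
    qed
    have "Ck_on k (\<lambda>x. det (\<chi> i j. if j = l then v $ i else ?M x $ i $ j)) S" for l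
      unfolding det_def
    proof (intro Ck_on_sum Ck_on_bilinear[OF bounded_bilinear_mult] Ck_on_const Ck_on_prod S)
      show "Ck_on k (\<lambda>x. (\<chi> i j. if j = l then v $ i else ?M x $ i $ j) $ i $ p i) S" for p i
        by (cases "p i = l") (simp_all add: Ck_on_const M)
    qed
    moreover have "Ck_on k (\<lambda>x. det (?M x)) S"
      unfolding det_def
      by (intro Ck_on_sum Ck_on_bilinear[OF bounded_bilinear_mult] Ck_on_const Ck_on_prod S M)
    ultimately show ?thesis
      using det by (intro Ck_on_vec[OF S])
        (auto intro!: Ck_on_bilinear[OF bounded_bilinear_mult S] Ck_on_inverse[OF S])
  qed
  moreover have G: "(?G has_derivative ?N (?G y)) (at y)" if "y \<in> F ` S" for y
  proof -
    obtain x where x: "x \<in> S" "y = F x" using \<open>y \<in> F ` S\<close> by blast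
    have "?N x \<circ> derivative1 F x = id" using NF[OF x(1)] by (auto simp: fun_eq_iff)
    from has_derivative_inverse_dieudonne[OF S oFS contF contG _ x(1) smooth_on_has_derivative[OF F x(1)] _ this]
    have "(?G has_derivative ?N x) (at (F x))"
      using inj linN[OF x(1)] by (simp add: linear_conv_bounded_linear)
    moreover have "?G y = x" using inj x by simp
    ultimately show ?thesis by (simp only: x(2))
  qed
  ultimately have "Ck_on k ?G (F ` S)" for k
  proof (induction k)
    case 0
    then show ?case using contG by simp
  next
    case (Suc k)
    show ?case
      by (rule Ck_on_SucI[OF oFS G])
        (auto intro!: Ck_on_compose[OF oFS S, of ?G] Suc simp: inv_into_into)
  qed
  then show "smooth_on ?G (F ` S)" by (simp add: smooth_on_def)
qed

section \<open>Charts and local diffeomorphisms\<close>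

lemma is_chart_inj_on: "is_chart T c \<Longrightarrow> inj_on (snd c) (fst c)"
  unfolding is_chart_def by (metis homeomorphic_imp_injective_map inf.absorb2 openin_subset topspace_subtopology)

lemma is_chart_open_image:
  assumes c: "is_chart T c" and U: "openin T U"
  shows "open (snd c ` (fst c \<inter> U))"
proof -
  have c': "openin T (fst c)" "open (snd c ` fst c)"
    "homeomorphic_map (subtopology T (fst c)) (top_of_set (snd c ` fst c)) (snd c)"
    using c by (simp_all add: is_chart_def)
  have "openin (subtopology T (fst c)) (fst c \<inter> U)"
    using U by (metis inf_commute openin_subtopology)
  then have "openin (top_of_set (snd c ` fst c)) (snd c ` (fst c \<inter> U))"
    using homeomorphic_imp_open_map[OF c'(3)] by (simp add: open_map_def)
  then show ?thesis
    using c'(2) openin_open_trans by blast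
qed

lemma smooth_manifold_is_chart: "smooth_manifold M \<Longrightarrow> c \<in> atlas M \<Longrightarrow> is_chart (mtop M) c"
  by (simp add: smooth_manifold_def)

lemma smooth_manifold_chart_subset: "smooth_manifold M \<Longrightarrow> c \<in> atlas M \<Longrightarrow> fst c \<subseteq> topspace (mtop M)"
  by (auto simp: smooth_manifold_def)

lemma smooth_manifold_ex_chart: "smooth_manifold M \<Longrightarrow> x \<in> topspace (mtop M) \<Longrightarrow> \<exists>c\<in>atlas M. x \<in> fst c"
  by (auto simp: smooth_manifold_def)

text \<open>A surjective local diffeomorphism from an open set, expressed through its smooth local
  sections.\<close>

locale etale_map =
  fixes X :: "('x, 'e::real_normed_vector) manifold"
    and S :: "'f::real_normed_vector set" and P :: "'f \<Rightarrow> 'x"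
  assumes manifold: "smooth_manifold X"
    and open_S: "open S"
    and surj: "P ` S = topspace (mtop X)"
    and cont: "continuous_map (top_of_set S) (mtop X) P"
    and smooth: "\<And>c. c \<in> atlas X \<Longrightarrow> smooth_on (\<lambda>y. snd c (P y)) {y \<in> S. P y \<in> fst c}"
    and sections: "\<And>y. y \<in> S \<Longrightarrow> \<exists>V s. open V \<and> y \<in> V \<and> V \<subseteq> S \<and> openin (mtop X) (P ` V) \<and>
      (\<forall>z\<in>V. s (P z) = z) \<and> continuous_map (subtopology (mtop X) (P ` V)) euclidean s \<and>
      (\<forall>c\<in>atlas X. smooth_on (\<lambda>e. s (inv_into (fst c) (snd c) e)) (snd c ` (fst c \<inter> P ` V)))"
begin

lemma open_preimage: "openin (mtop X) U \<Longrightarrow> open {y \<in> S. P y \<in> U}"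
  using openin_continuous_map_preimage[OF cont] open_S
  by (simp add: openin_open_eq)

lemma open_chart_preimage: "c \<in> atlas X \<Longrightarrow> open {y \<in> S. P y \<in> fst c}"
  using smooth_manifold_is_chart[OF manifold] by (intro open_preimage) (simp add: is_chart_def)

text \<open>Near a point of U a section s inverts P, so P(V \<inter> U) is the preimage of U under
  the continuous s.\<close>

lemma open_image:
  assumes U: "open U" "U \<subseteq> S"
  shows "openin (mtop X) (P ` U)"
proof (subst openin_subopen, intro ballI)
  fix x assume "x \<in> P ` U"
  then obtain y where y: "y \<in> U" "x = P y" by blast
  obtain V s where V: "open V" "y \<in> V" "V \<subseteq> S" "openin (mtop X) (P ` V)" "\<And>z. z \<in> V \<Longrightarrow> s (P z) = z"
    "continuous_map (subtopology (mtop X) (P ` V)) euclidean s"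
    using sections[of y] y U by blast
  have "openin (subtopology (mtop X) (P ` V)) {x \<in> topspace (subtopology (mtop X) (P ` V)). s x \<in> U}"
    using V(6) U(1) by (intro openin_continuous_map_preimage) auto
  moreover have "{x \<in> topspace (subtopology (mtop X) (P ` V)). s x \<in> U} = P ` (V \<inter> U)"
    using V(3,5) surj by auto
  ultimately have "openin (mtop X) (P ` (V \<inter> U))"
    using V(4) openin_trans_full by metis
  then show "\<exists>T. openin (mtop X) T \<and> x \<in> T \<and> T \<subseteq> P ` U"
    using y V(2) by blast
qed

lemma quotient_map: "quotient_map (top_of_set S) (mtop X) P"
proof (rule continuous_open_imp_quotient_map[OF cont])
  show "open_map (top_of_set S) (mtop X) P"
    using open_image open_S by (simp add: open_map_def openin_open_eq)
qed (simp add: surj)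

text \<open>The section in coordinates is a local inverse of c o P on both sides. Both compositions
  are differentiated, because S and the charts may lie in different spaces and one identity alone
  gives only injectivity or only surjectivity.\<close>

lemma bij_derivative1:
  assumes c: "c \<in> atlas X" and y: "y \<in> S" "P y \<in> fst c"
  shows "bij (derivative1 (\<lambda>y. snd c (P y)) y)"
proof -
  let ?\<tau> = "\<lambda>y. snd c (P y)" and ?D = "{y \<in> S. P y \<in> fst c}"
  obtain V s where V: "open V" "y \<in> V" "V \<subseteq> S" "openin (mtop X) (P ` V)" "\<And>z. z \<in> V \<Longrightarrow> s (P z) = z"
    and "smooth_on (\<lambda>e. s (inv_into (fst c) (snd c) e)) (snd c ` (fst c \<inter> P ` V))"
    using sections[OF y(1)] c by blast
  moreover define h where "h = (\<lambda>e. s (inv_into (fst c) (snd c) e))"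
  moreover define A where "A = snd c ` (fst c \<inter> P ` V)"
  ultimately have h: "smooth_on h A" by simp
  note chart = smooth_manifold_is_chart[OF manifold c]
  have A: "open A" "?\<tau> y \<in> A"
    unfolding A_def using is_chart_open_image[OF chart V(4)] y V(2) by auto
  have h\<tau>: "h (?\<tau> z) = z" if "z \<in> V \<inter> ?D" for z
    unfolding h_def using that V(5) is_chart_inj_on[OF chart] by simp
  have \<tau>h: "?\<tau> (h e) = e" if "e \<in> A" for e
    using that V(5) is_chart_inj_on[OF chart] by (auto simp: A_def h_def)
  have D\<tau>: "(?\<tau> has_derivative derivative1 ?\<tau> y) (at y)"
    using smooth_on_has_derivative[OF smooth[OF c]] y by simp
  have Dh: "(h has_derivative derivative1 h (?\<tau> y)) (at (?\<tau> y))"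
    using smooth_on_has_derivative[OF h A(2)] .
  have oVD: "open (V \<inter> ?D)"
    using V(1) open_chart_preimage[OF c] by blast
  have yVD: "y \<in> V \<inter> ?D" using y V(2) by simp
  have "((\<lambda>z. z) has_derivative (\<lambda>u. derivative1 h (?\<tau> y) (derivative1 ?\<tau> y u))) (at y)"
    by (rule has_derivative_transform_within_open[OF has_derivative_compose[OF D\<tau> Dh] oVD yVD h\<tau>])
  from has_derivative_unique[OF this has_derivative_ident]
  have 1: "derivative1 h (?\<tau> y) \<circ> derivative1 ?\<tau> y = id"
    by (auto simp: fun_eq_iff)
  have "(?\<tau> has_derivative derivative1 ?\<tau> y) (at (h (?\<tau> y)))"
    using D\<tau> h\<tau>[OF yVD] by simp
  from has_derivative_transform_within_open[OF has_derivative_compose[OF Dh this] A \<tau>h]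
  have "((\<lambda>z. z) has_derivative (\<lambda>u. derivative1 ?\<tau> y (derivative1 h (?\<tau> y) u))) (at (?\<tau> y))" .
  from has_derivative_unique[OF this has_derivative_ident]
  have 2: "derivative1 ?\<tau> y \<circ> derivative1 h (?\<tau> y) = id"
    by (auto simp: fun_eq_iff)
  from 1 2 show ?thesis by (rule o_bij)
qed

end

text \<open>Composing with F turns a section s of P into the section F o s of P o F^-1 over the same
  open set of X. This moves the covering from \<Omega> to the gradient image.\<close>

lemma etale_map_reparametrize:
  fixes P :: "'f::euclidean_space \<Rightarrow> 'x" and F :: "'f \<Rightarrow> 'g::real_normed_vector"
    and X :: "('x, 'e::real_normed_vector) manifold"
  assumes "etale_map X S P" and oFS: "open (F ` S)" and inj: "inj_on F S"
    and F: "smooth_on F S" and G: "smooth_on (inv_into S F) (F ` S)"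
  shows "etale_map X (F ` S) (\<lambda>\<xi>. P (inv_into S F \<xi>))"
proof -
  interpret etale_map X S P by fact
  let ?G = "inv_into S F"
  have GF: "?G (F y) = y" if "y \<in> S" for y using inj that by simp
  have contG: "continuous_on (F ` S) ?G" using G by (rule smooth_on_continuous)
  have contF: "continuous_on S F" using F by (rule smooth_on_continuous)
  have G_open: "open {\<xi> \<in> F ` S. ?G \<xi> \<in> U}" if "open U" for U
    using continuous_open_preimage[OF contG oFS that] by (simp add: vimage_def Int_def)
  show ?thesis
  proof
    show "smooth_manifold X" by (rule manifold)
    show "open (F ` S)" by (rule oFS)
    show "(\<lambda>\<xi>. P (?G \<xi>)) ` F ` S = topspace (mtop X)"
      using GF surj by (auto simp: image_image)
    have "continuous_map (top_of_set (F ` S)) (top_of_set S) ?G"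
      using contG GF by (auto simp: continuous_map_in_subtopology)
    from continuous_map_compose[OF this cont]
    show "continuous_map (top_of_set (F ` S)) (mtop X) (\<lambda>\<xi>. P (?G \<xi>))" by (simp add: o_def)
  next
    fix c assume c: "c \<in> atlas X"
    have "{y \<in> F ` S. P (?G y) \<in> fst c} = {y \<in> F ` S. ?G y \<in> {y \<in> S. P y \<in> fst c}}"
      using GF by auto
    moreover have "smooth_on (\<lambda>y. snd c (P (?G y))) {y \<in> F ` S. ?G y \<in> {y \<in> S. P y \<in> fst c}}"
    proof (rule smooth_on_compose[OF G_open open_chart_preimage[OF c] _ smooth[OF c]])
      show "open {y \<in> S. P y \<in> fst c}" by (rule open_chart_preimage[OF c])
    qed (auto intro: smooth_on_subset[OF G])
    ultimately show "smooth_on (\<lambda>y. snd c (P (?G y))) {y \<in> F ` S. P (?G y) \<in> fst c}"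
      by simp
  next
    fix y assume "y \<in> F ` S"
    then obtain x where x: "x \<in> S" "y = F x" by blast
    obtain V s where V: "open V" "x \<in> V" "V \<subseteq> S" "openin (mtop X) (P ` V)" "\<And>z. z \<in> V \<Longrightarrow> s (P z) = z"
      and s: "continuous_map (subtopology (mtop X) (P ` V)) euclidean s"
        "\<And>c. c \<in> atlas X \<Longrightarrow> smooth_on (\<lambda>e. s (inv_into (fst c) (snd c) e)) (snd c ` (fst c \<inter> P ` V))"
      using sections[OF x(1)] by blast
    have im: "(\<lambda>\<xi>. P (?G \<xi>)) ` F ` V = P ` V"
      using GF V(3) by (force simp: image_image)
    have "F ` V = {\<xi> \<in> F ` S. ?G \<xi> \<in> V}"
      using GF V(3) by force
    then have "open (F ` V)" using G_open[OF V(1)] by simp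
    moreover have "continuous_map (subtopology (mtop X) (P ` V)) euclidean (\<lambda>x. F (s x))"
    proof -
      have "continuous_map (subtopology (mtop X) (P ` V)) (top_of_set S) s"
        using s(1) V(3,5) by (auto simp: continuous_map_in_subtopology)
      moreover have "continuous_map (top_of_set S) euclidean F" using contF by simp
      ultimately have "continuous_map (subtopology (mtop X) (P ` V)) euclidean (F \<circ> s)"
        by (rule continuous_map_compose)
      then show ?thesis by (simp add: o_def)
    qed
    moreover have "smooth_on (\<lambda>e. F (s (inv_into (fst c) (snd c) e))) (snd c ` (fst c \<inter> P ` V))"
      if c: "c \<in> atlas X" for c
    proof (rule smooth_on_compose[OF _ open_S _ F s(2)[OF c]])
      note chart = smooth_manifold_is_chart[OF manifold c]
      show "open (snd c ` (fst c \<inter> P ` V))"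
        by (rule is_chart_open_image[OF chart V(4)])
      show "(\<lambda>e. s (inv_into (fst c) (snd c) e)) ` snd c ` (fst c \<inter> P ` V) \<subseteq> S"
        using is_chart_inj_on[OF chart] V(3,5) by auto
    qed
    ultimately show "\<exists>V s. open V \<and> y \<in> V \<and> V \<subseteq> F ` S \<and> openin (mtop X) ((\<lambda>\<xi>. P (?G \<xi>)) ` V) \<and>
      (\<forall>z\<in>V. s (P (?G z)) = z) \<and> continuous_map (subtopology (mtop X) ((\<lambda>\<xi>. P (?G \<xi>)) ` V)) euclidean s \<and>
      (\<forall>c\<in>atlas X. smooth_on (\<lambda>e. s (inv_into (fst c) (snd c) e)) (snd c ` (fst c \<inter> (\<lambda>\<xi>. P (?G \<xi>)) ` V)))"
      using V x GF unfolding im[symmetric]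
      by (intro exI[of _ "F ` V"] exI[of _ "\<lambda>x. F (s x)"]) (auto simp: subset_iff)
  qed
qed

text \<open>A sheet V over an evenly covered set U is mapped diffeomorphically onto U, and the
  inverse is the required section. The remaining work matches the restricted charts of the open
  submanifolds with those of X.\<close>

lemma etale_map_universal_covering:
  fixes p :: "'f::real_normed_vector \<Rightarrow> 'x" and X :: "('x, 'e::real_normed_vector) manifold"
  assumes X: "smooth_manifold X" and S: "open S" and p: "universal_covering S X p"
  shows "etale_map X S p"
proof -
  have cov: "smooth_map (domain_manifold S) X p" "p ` S = topspace (mtop X)"
    "\<And>y. y \<in> topspace (mtop X) \<Longrightarrow> \<exists>U. y \<in> U \<and> openin (mtop X) U \<and>
        (\<exists>\<V>. \<Union>\<V> = {x \<in> S. p x \<in> U} \<and> pairwise disjnt \<V> \<and>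
             (\<forall>V\<in>\<V>. openin (top_of_set S) V \<and>
                diffeomorphism (open_submanifold (domain_manifold S) V) (open_submanifold X U) p))"
    using p by (auto simp: universal_covering_def smooth_covering_def domain_manifold_def)
  have cont: "continuous_map (top_of_set S) (mtop X) p"
    using cov(1) by (simp add: smooth_map_def domain_manifold_def)
  show ?thesis
  proof
    show "smooth_manifold X" "open S" "p ` S = topspace (mtop X)" "continuous_map (top_of_set S) (mtop X) p"
      by fact+
  next
    fix c assume c: "c \<in> atlas X"
    have "openin (mtop X) (fst c)"
      using smooth_manifold_is_chart[OF X c] by (simp add: is_chart_def)
    then have "open {y \<in> S. p y \<in> fst c}"
      using openin_continuous_map_preimage[OF cont] S by (simp add: openin_open_eq)
    moreover have "smooth_on (snd c \<circ> p \<circ> inv_into S id) {y \<in> S. p y \<in> fst c}"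
      using cov(1) c by (auto simp: smooth_map_def domain_manifold_def local_rep_def local_dom_def)
    moreover have "inv_into S id y = y" if "y \<in> S" for y
      using inv_into_f_f[of id S y] that by simp
    ultimately show "smooth_on (\<lambda>y. snd c (p y)) {y \<in> S. p y \<in> fst c}"
      by (subst smooth_on_cong[where g = "snd c \<circ> p \<circ> inv_into S id"]) auto
  next
    fix y assume y: "y \<in> S"
    then have "p y \<in> topspace (mtop X)" using cov(2) by blast
    from cov(3)[OF this] obtain U where U: "p y \<in> U" "openin (mtop X) U"
      and "\<exists>\<V>. \<Union>\<V> = {x \<in> S. p x \<in> U} \<and> pairwise disjnt \<V> \<and> (\<forall>V\<in>\<V>. openin (top_of_set S) V \<and>
        diffeomorphism (open_submanifold (domain_manifold S) V) (open_submanifold X U) p)"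
      by blast
    then obtain \<V> where \<V>: "\<Union>\<V> = {x \<in> S. p x \<in> U}" "\<forall>V\<in>\<V>. openin (top_of_set S) V \<and>
        diffeomorphism (open_submanifold (domain_manifold S) V) (open_submanifold X U) p"
      by blast
    have "y \<in> \<Union>\<V>" using \<V>(1) U(1) y by simp
    then obtain V where V: "V \<in> \<V>" "y \<in> V" by blast
    then have V': "open V" "V \<subseteq> S" and
      diffeo: "diffeomorphism (open_submanifold (domain_manifold S) V) (open_submanifold X U) p"
      using \<V>(2) S openin_open_eq by blast+
    obtain s where s: "smooth_map (open_submanifold (domain_manifold S) V) (open_submanifold X U) p"
      "smooth_map (open_submanifold X U) (open_submanifold (domain_manifold S) V) s"
      "\<And>x. x \<in> V \<Longrightarrow> s (p x) = x" "\<And>x. x \<in> topspace (mtop X) \<inter> U \<Longrightarrow> p (s x) = x"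
      using diffeo V' by (auto simp: diffeomorphism_def open_submanifold_def domain_manifold_def)
    have UX: "U \<subseteq> topspace (mtop X)" using U(2) by (rule openin_subset)
    have "continuous_map (subtopology (top_of_set S) V) (subtopology (mtop X) U) p"
      using s(1) by (simp add: smooth_map_def open_submanifold_def domain_manifold_def)
    then have pV: "p ` V \<subseteq> U"
      using V' by (auto simp: continuous_map_in_subtopology)
    have conts: "continuous_map (subtopology (mtop X) U) (subtopology (top_of_set S) V) s"
      using s(2) by (simp add: smooth_map_def open_submanifold_def domain_manifold_def)
    then have sU: "s ` U \<subseteq> V"
      using UX by (auto simp: continuous_map_in_subtopology)
    have pV_eq: "p ` V = U"
      using pV sU s(4) UX by force
    moreover have "continuous_map (subtopology (mtop X) U) euclidean s"
      using conts by (simp add: continuous_map_in_subtopology)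
    moreover have "smooth_on (\<lambda>e. s (inv_into (fst c) (snd c) e)) (snd c ` (fst c \<inter> U))" if c: "c \<in> atlas X" for c
    proof -
      note chart = smooth_manifold_is_chart[OF X c]
      have "(fst c \<inter> U, snd c) \<in> atlas (open_submanifold X U)"
        using c by (force simp: open_submanifold_def)
      moreover have "(S \<inter> V, id) \<in> atlas (open_submanifold (domain_manifold S) V)"
        by (simp add: open_submanifold_def domain_manifold_def)
      ultimately have "smooth_on (local_rep (fst c \<inter> U, snd c) (S \<inter> V, id) s) (local_dom (fst c \<inter> U, snd c) (S \<inter> V, id) s)"
        using s(2) unfolding smooth_map_def by blast
      moreover have "local_dom (fst c \<inter> U, snd c) (S \<inter> V, id) s = snd c ` (fst c \<inter> U)"
        using sU V' by (auto simp: local_dom_def)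
      moreover have rep: "local_rep (fst c \<inter> U, snd c) (S \<inter> V, id) s e = s (inv_into (fst c) (snd c) e)"
        if "e \<in> snd c ` (fst c \<inter> U)" for e
      proof -
        obtain x where x: "x \<in> fst c \<inter> U" "e = snd c x"
          using \<open>e \<in> snd c ` (fst c \<inter> U)\<close> by blast
        have "inv_into (fst c \<inter> U) (snd c) e = x"
          unfolding x(2) using x(1) is_chart_inj_on[OF chart] by (meson inf_le1 inj_on_subset inv_into_f_f)
        moreover have "inv_into (fst c) (snd c) e = x"
          unfolding x(2) using x(1) is_chart_inj_on[OF chart] by simp
        ultimately show ?thesis by (simp add: local_rep_def)
      qed
      ultimately show ?thesis
        using smooth_on_cong[OF is_chart_open_image[OF chart U(2)] rep] by simp
    qed
    ultimately show "\<exists>V s. open V \<and> y \<in> V \<and> V \<subseteq> S \<and> openin (mtop X) (p ` V) \<and> (\<forall>z\<in>V. s (p z) = z) \<and>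
      continuous_map (subtopology (mtop X) (p ` V)) euclidean s \<and>
      (\<forall>c\<in>atlas X. smooth_on (\<lambda>e. s (inv_into (fst c) (snd c) e)) (snd c ` (fst c \<inter> p ` V)))"
      using V' V(2) U(2) s(3) by (intro exI[of _ V] exI[of _ s]) (simp add: pV_eq)
  qed
qed


section \<open>Quotients by affine deck transformations\<close>

text \<open>G enters only through its orbits on S: a pushed action is defined by a choice of
  preimages and is arbitrary off S, so G is not treated as a group of maps of the whole space. The
  affine maps needed for the atlas are supplied pointwise by \<open>affine_deck\<close>.\<close>

locale affine_etale_quotient = etale_map X S P
  for X :: "('x, 'e::real_normed_vector) manifold"
    and S :: "'f::real_normed_vector set" and P :: "'f \<Rightarrow> 'x" +
  fixes G :: "('f \<Rightarrow> 'f) set"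
  assumes fibres: "\<And>y y'. y \<in> S \<Longrightarrow> y' \<in> S \<Longrightarrow> orbit G y = orbit G y' \<longleftrightarrow> P y = P y'"
    and affine_deck: "\<And>y y'. y \<in> S \<Longrightarrow> y' \<in> S \<Longrightarrow> P y = P y' \<Longrightarrow> \<exists>L c. bounded_linear L \<and>
      L y + c = y' \<and> (\<forall>z\<in>S. L z + c \<in> S \<and> P (L z + c) = P z)"
begin

abbreviation "Q \<equiv> quotient_manifold S G"
abbreviation "q \<equiv> orbit G"

definition induced :: "'f set \<Rightarrow> 'x" where
  "induced \<omega> = P (inv_into S q \<omega>)"

definition induced_inv :: "'x \<Rightarrow> 'f set" where
  "induced_inv x = q (inv_into S P x)"

lemma mtop_Q: "mtop Q = quotient_topology (top_of_set S) q"
  by (simp add: quotient_manifold_def)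

lemma atlas_Q: "atlas Q = {(q ` W, inv_into W q) | W. open W \<and> W \<subseteq> S \<and> inj_on q W}"
  by (simp add: quotient_manifold_def)

section \<open>Topology of the quotient\<close>

lemma quotient_map_q: "quotient_map (top_of_set S) (mtop Q) q"
  unfolding mtop_Q by (rule quotient_map_quotient_topology)

lemma topspace_Q: "topspace (mtop Q) = q ` S"
  using quotient_imp_surjective_map[OF quotient_map_q] by simp

lemma induced_q: "y \<in> S \<Longrightarrow> induced (q y) = P y"
  unfolding induced_def by (metis f_inv_into_f fibres image_eqI inv_into_into)

lemma induced_inv_P: "y \<in> S \<Longrightarrow> induced_inv (P y) = q y"
  unfolding induced_inv_def by (metis f_inv_into_f fibres image_eqI inv_into_into)

text \<open>Both q and P are quotient maps of S with the same fibres, so each factors continuously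
  through the other.\<close>

lemma homeomorphic_maps_induced: "homeomorphic_maps (mtop Q) (mtop X) induced induced_inv"
proof -
  have "continuous_map (top_of_set S) (mtop X) (induced \<circ> q)"
    by (rule continuous_map_eq[OF cont]) (simp add: induced_q)
  then have 1: "continuous_map (mtop Q) (mtop X) induced"
    using continuous_compose_quotient_map_eq[OF quotient_map_q] by blast
  have "continuous_map (top_of_set S) (mtop Q) (induced_inv \<circ> P)"
    by (rule continuous_map_eq[OF quotient_imp_continuous_map[OF quotient_map_q]])
      (simp add: induced_inv_P)
  then have 2: "continuous_map (mtop X) (mtop Q) induced_inv"
    using continuous_compose_quotient_map_eq[OF quotient_map] by blast
  have "\<forall>x\<in>topspace (mtop Q). induced_inv (induced x) = x"
    by (simp add: topspace_Q induced_q induced_inv_P)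
  moreover have "\<forall>y\<in>topspace (mtop X). induced (induced_inv y) = y"
    unfolding surj[symmetric] by (simp add: induced_q induced_inv_P)
  ultimately show ?thesis
    using 1 2 by (simp add: homeomorphic_maps_def)
qed

text \<open>The saturation of U under q is its saturation under P, and the latter is open because P
  is continuous and open.\<close>

lemma q_open_image:
  assumes "open U" "U \<subseteq> S"
  shows "openin (mtop Q) (q ` U)"
proof -
  have "{y \<in> S. q y \<in> q ` U} = {y \<in> S. P y \<in> P ` U}"
    using fibres assms(2) by (auto simp: image_iff subset_iff)
  moreover have "open {y \<in> S. P y \<in> P ` U}"
    by (rule open_preimage[OF open_image[OF assms]])
  ultimately show ?thesis
    unfolding mtop_Q openin_quotient_topology using assms(2) open_S by (auto simp: openin_open_eq)
qed

lemma is_chart_Q: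
  assumes W: "open W" "W \<subseteq> S" "inj_on q W"
  shows "is_chart (mtop Q) (q ` W, inv_into W q)"
proof -
  have im: "inv_into W q ` q ` W = W"
    using W(3) by (simp add: image_image)
  have "homeomorphic_map (top_of_set W) (subtopology (mtop Q) (q ` W)) q"
  proof (rule bijective_open_imp_homeomorphic_map)
    have "continuous_map (top_of_set W) (mtop Q) q"
      using continuous_map_from_subtopology[OF quotient_imp_continuous_map[OF quotient_map_q], of W] W(2)
      by (simp add: subtopology_subtopology Int_absorb1)
    then show "continuous_map (top_of_set W) (subtopology (mtop Q) (q ` W)) q"
      by (auto simp: continuous_map_in_subtopology)
    show "open_map (top_of_set W) (subtopology (mtop Q) (q ` W)) q"
      unfolding open_map_def
    proof (intro allI impI)
      fix U assume "openin (top_of_set W) U"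
      then have "open U" "U \<subseteq> W" using W(1) openin_open_eq by blast+
      then show "openin (subtopology (mtop Q) (q ` W)) (q ` U)"
        using q_open_image[of U] W(2) by (auto simp: openin_subtopology intro!: exI[of _ "q ` U"])
    qed
    show "q ` topspace (top_of_set W) = topspace (subtopology (mtop Q) (q ` W))"
      using W(2) by (auto simp: topspace_Q)
    show "inj_on q (topspace (top_of_set W))" using W(3) by simp
  qed
  then obtain h where h: "homeomorphic_maps (top_of_set W) (subtopology (mtop Q) (q ` W)) q h"
    using homeomorphic_map_maps by blast
  then have "homeomorphic_map (subtopology (mtop Q) (q ` W)) (top_of_set W) h"
    using homeomorphic_maps_map by blast
  moreover have "h \<omega> = inv_into W q \<omega>" if "\<omega> \<in> topspace (subtopology (mtop Q) (q ` W))" for \<omega>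
    using that h W(3) by (auto simp: homeomorphic_maps_def)
  ultimately have "homeomorphic_map (subtopology (mtop Q) (q ` W)) (top_of_set W) (inv_into W q)"
    using homeomorphic_map_eq by blast
  then show ?thesis
    using q_open_image[OF W(1,2)] W(1) by (simp add: is_chart_def im)
qed

text \<open>P, and hence q, is injective wherever a section inverts it.\<close>

lemma ex_injective_neighbourhood:
  assumes "y \<in> S"
  shows "\<exists>W. open W \<and> W \<subseteq> S \<and> inj_on q W \<and> y \<in> W"
proof -
  obtain V s where V: "open V" "y \<in> V" "V \<subseteq> S" "\<And>z. z \<in> V \<Longrightarrow> s (P z) = z"
    using sections[OF assms] by blast
  have "inj_on q V"
  proof (rule inj_onI)
    fix a b assume "a \<in> V" "b \<in> V" "q a = q b"
    moreover from this have "P a = P b" using fibres V(3) by blast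
    ultimately show "a = b" using V(4) by metis
  qed
  with V show ?thesis by blast
qed

section \<open>The affine atlas of the quotient\<close>

lemma local_rep_Q:
  assumes W: "open W" "W \<subseteq> S" "inj_on q W" and z: "z \<in> W"
  shows "local_rep (q ` W, inv_into W q) c f z = snd c (f (q z))"
proof -
  have "inv_into (q ` W) (inv_into W q) z = q z"
    using W(3) z by (intro inv_into_f_eq) (auto intro: inj_on_inv_into)
  then show ?thesis by (simp add: local_rep_def)
qed

lemma local_dom_Q:
  assumes "inj_on q W"
  shows "local_dom (q ` W, inv_into W q) c f = {z \<in> W. f (q z) \<in> fst c}"
  using assms by (force simp: local_dom_def)

text \<open>Two representatives y and y' of one orbit are related by an affine deck map, and this
  map is the transition near y. It may change with y, since overlaps need not be connected; hence
  the local form.\<close>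

lemma transition_Q_affine:
  assumes W: "open W" "W \<subseteq> S" "inj_on q W" and W': "open W'" "W' \<subseteq> S" "inj_on q W'"
    and y: "y \<in> local_dom (q ` W, inv_into W q) (q ` W', inv_into W' q) id"
  obtains U L c where "open U" "y \<in> U" "bounded_linear L"
    "\<And>z. z \<in> U \<Longrightarrow> local_rep (q ` W, inv_into W q) (q ` W', inv_into W' q) id z = L z + c"
proof -
  obtain y' where y': "y \<in> W" "y' \<in> W'" "q y = q y'"
    using y by (auto simp: local_dom_Q[OF W(3)])
  then have "P y = P y'" using fibres W(2) W'(2) by blast
  then obtain L c where L: "bounded_linear L" "L y + c = y'" "\<And>z. z \<in> S \<Longrightarrow> L z + c \<in> S \<and> P (L z + c) = P z"
    using affine_deck[of y y'] y' W(2) W'(2) by blast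
  show ?thesis
  proof
    \<comment> \<open>W is cut down to the points that the affine map sends into W', where
      \<open>inv_into W' q\<close> returns exactly that image.\<close>
    have "continuous_on UNIV (\<lambda>z. L z + c)"
      using L(1) by (intro continuous_on_add linear_continuous_on continuous_on_const)
    then have "open ((\<lambda>z. L z + c) -` W')"
      using W'(1) open_vimage by blast
    then show "open (W \<inter> (\<lambda>z. L z + c) -` W')" using W(1) by blast
    show "y \<in> W \<inter> (\<lambda>z. L z + c) -` W'" using y' L(2) by simp
    show "bounded_linear L" by fact
    fix z assume z: "z \<in> W \<inter> (\<lambda>z. L z + c) -` W'"
    then have "q z = q (L z + c)"
      using L(3)[of z] fibres[of z "L z + c"] W(2) by auto
    then have "inv_into W' q (q z) = L z + c"
      using z W'(3) by simp
    then show "local_rep (q ` W, inv_into W q) (q ` W', inv_into W' q) id z = L z + c"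
      using z by (simp add: local_rep_Q[OF W])
  qed
qed

text \<open>The Hausdorff property and second countability are carried over from X along the
  homeomorphism, so no proper discontinuity of the action has to be established.\<close>

lemma smooth_manifold_Q: "smooth_manifold Q"
  unfolding smooth_manifold_def
proof (intro conjI ballI)
  have "mtop Q homeomorphic_space mtop X"
    using homeomorphic_maps_induced homeomorphic_space_def by blast
  then show "Hausdorff_space (mtop Q)" "second_countable (mtop Q)"
    using manifold homeomorphic_Hausdorff_space[of "mtop Q" "mtop X"]
      homeomorphic_space_second_countability[of "mtop Q" "mtop X"]
    by (simp_all add: smooth_manifold_def)
  show "is_chart (mtop Q) c" if "c \<in> atlas Q" for c
    using that is_chart_Q unfolding atlas_Q by blast
  show "topspace (mtop Q) = (\<Union>c\<in>atlas Q. fst c)"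
  proof
    show "topspace (mtop Q) \<subseteq> (\<Union>c\<in>atlas Q. fst c)"
    proof
      fix \<omega> assume "\<omega> \<in> topspace (mtop Q)"
      then obtain y where "y \<in> S" "\<omega> = q y" by (auto simp: topspace_Q)
      moreover from this obtain W where "open W" "W \<subseteq> S" "inj_on q W" "y \<in> W"
        using ex_injective_neighbourhood by blast
      ultimately have "(q ` W, inv_into W q) \<in> atlas Q" "\<omega> \<in> fst (q ` W, inv_into W q)"
        unfolding atlas_Q by auto
      then show "\<omega> \<in> (\<Union>c\<in>atlas Q. fst c)" by blast
    qed
    show "(\<Union>c\<in>atlas Q. fst c) \<subseteq> topspace (mtop Q)"
      unfolding atlas_Q topspace_Q by (auto intro!: imageI)
  qed
  fix c c' assume "c \<in> atlas Q" "c' \<in> atlas Q"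
  then obtain W W' where W: "open W" "W \<subseteq> S" "inj_on q W" and W': "open W'" "W' \<subseteq> S" "inj_on q W'"
    and c: "c = (q ` W, inv_into W q)" and c': "c' = (q ` W', inv_into W' q)"
    unfolding atlas_Q by blast
  show "smooth_on (local_rep c c' id) (local_dom c c' id)"
  proof (rule smooth_on_locally)
    fix y assume "y \<in> local_dom c c' id"
    from transition_Q_affine[OF W W' this[unfolded c c']] obtain U L b where
      U: "open U" "y \<in> U" "bounded_linear L" "\<And>z. z \<in> U \<Longrightarrow> local_rep c c' id z = L z + b"
      unfolding c c' by metis
    then have "smooth_on (local_rep c c' id) U"
      using smooth_on_cong[of U "local_rep c c' id" "\<lambda>z. L z + b", OF U(1,4)] smooth_on_affine[OF U(3)] by blast
    with U(1,2) show "\<exists>T. open T \<and> y \<in> T \<and> smooth_on (local_rep c c' id) T" by blast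
  qed
qed

text \<open>Locally affine transitions have zero second derivative, which is the inhomogeneous term
  of the transformation law; so vanishing symbols are consistent.\<close>

lemma affine_manifold_Q: "affine_manifold Q standard_connection"
proof -
  have "carries_connection Q standard_connection Q standard_connection id"
    unfolding carries_connection_def Let_def
  proof (intro ballI allI)
    fix c c' y u v
    assume "c \<in> atlas Q" "c' \<in> atlas Q" and y: "y \<in> local_dom c c' id"
    then obtain W W' where W: "open W" "W \<subseteq> S" "inj_on q W" and W': "open W'" "W' \<subseteq> S" "inj_on q W'"
      and c: "c = (q ` W, inv_into W q)" and c': "c' = (q ` W', inv_into W' q)"
      unfolding atlas_Q by blast
    from transition_Q_affine[OF W W' y[unfolded c c']] obtain U L b where
      U: "open U" "y \<in> U" "bounded_linear L" "\<And>z. z \<in> U \<Longrightarrow> local_rep c c' id z = L z + b"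
      unfolding c c' by metis
    let ?\<tau> = "local_rep c c' id"
    have "smooth_on ?\<tau> U"
      using smooth_on_cong[of U "local_rep c c' id" "\<lambda>z. L z + b", OF U(1,4)] smooth_on_affine[OF U(3)] by blast
    then have "derivative1 ?\<tau> y 0 = 0"
      using smooth_on_linear U(2) linear_0 by blast
    moreover have "derivative2 ?\<tau> y u v = 0"
      using derivative2_cong[of U y ?\<tau> "\<lambda>z. L z + b", OF U(1,2,4)] by (simp add: derivative2_affine[OF U(3)])
    ultimately show "derivative1 ?\<tau> y (standard_connection c y u v) = derivative2 ?\<tau> y u v +
        standard_connection c' (?\<tau> y) (derivative1 ?\<tau> y u) (derivative1 ?\<tau> y v)"
      by (simp add: standard_connection_def)
  qed
  then show ?thesis
    using smooth_manifold_Q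
    by (simp add: affine_manifold_def is_connection_def torsion_free_def flat_def curvature_def
        standard_connection_def bilinear_def linear_zero smooth_on_const)
qed

lemma diffeomorphism_induced: "diffeomorphism Q X induced"
proof -
  have cont: "continuous_map (mtop Q) (mtop X) induced" "continuous_map (mtop X) (mtop Q) induced_inv"
    and inv: "\<forall>x\<in>topspace (mtop Q). induced_inv (induced x) = x" "\<forall>y\<in>topspace (mtop X). induced (induced_inv y) = y"
    using homeomorphic_maps_induced by (simp_all add: homeomorphic_maps_def)
  have "smooth_on (local_rep c c' induced) (local_dom c c' induced)" if "c \<in> atlas Q" "c' \<in> atlas X" for c c'
  proof -
    obtain W where W: "open W" "W \<subseteq> S" "inj_on q W" and c: "c = (q ` W, inv_into W q)"
      using \<open>c \<in> atlas Q\<close> unfolding atlas_Q by blast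
    have dom: "local_dom c c' induced = W \<inter> {y \<in> S. P y \<in> fst c'}"
      unfolding c local_dom_Q[OF W(3)] using W(2) by (auto simp: induced_q subset_iff)
    have "open (W \<inter> {y \<in> S. P y \<in> fst c'})"
      using W(1) open_chart_preimage[OF \<open>c' \<in> atlas X\<close>] by blast
    then show ?thesis
      unfolding dom
      by (subst smooth_on_cong[where g = "\<lambda>y. snd c' (P y)"])
        (auto simp: c local_rep_Q[OF W] induced_q intro: smooth_on_subset[OF smooth[OF \<open>c' \<in> atlas X\<close>]])
  qed
  then have 1: "smooth_map Q X induced"
    using cont by (simp add: smooth_map_def)
  have "smooth_on (local_rep c c' induced_inv) (local_dom c c' induced_inv)" if "c \<in> atlas X" "c' \<in> atlas Q" for c c'
  proof (rule smooth_on_locally)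
    fix e assume e: "e \<in> local_dom c c' induced_inv"
    note chart = smooth_manifold_is_chart[OF manifold \<open>c \<in> atlas X\<close>]
    obtain W where W: "open W" "W \<subseteq> S" "inj_on q W" and c': "c' = (q ` W, inv_into W q)"
      using \<open>c' \<in> atlas Q\<close> unfolding atlas_Q by blast
    obtain x where x: "x \<in> fst c" "induced_inv x \<in> q ` W" "e = snd c x"
      using e by (auto simp: local_dom_def c')
    obtain w where w: "w \<in> W" "induced_inv x = q w" using x(2) by blast
    have "x \<in> topspace (mtop X)"
      using smooth_manifold_chart_subset[OF manifold \<open>c \<in> atlas X\<close>] x(1) by blast
    then have "x = P w"
      using inv(2) w induced_q W(2) by (metis subsetD)
    obtain V s where V: "open V" "w \<in> V" "V \<subseteq> S" "\<And>z. z \<in> V \<Longrightarrow> s (P z) = z"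
      and s: "smooth_on (\<lambda>e. s (inv_into (fst c) (snd c) e)) (snd c ` (fst c \<inter> P ` V))"
      using sections[of w] w(1) W(2) \<open>c \<in> atlas X\<close> by blast
    \<comment> \<open>Intersecting with W makes the chart \<open>inv_into W q\<close> return the
      very point that the section returns.\<close>
    let ?A = "snd c ` (fst c \<inter> P ` (V \<inter> W))"
    have A: "open ?A"
      using V(1,3) W(1) by (intro is_chart_open_image[OF chart] open_image) auto
    have rep: "local_rep c c' induced_inv e = s (inv_into (fst c) (snd c) e)" if "e \<in> ?A" for e
    proof -
      obtain v where v: "v \<in> V" "v \<in> W" "P v \<in> fst c" "e = snd c (P v)"
        using \<open>e \<in> ?A\<close> by blast
      have "inv_into (fst c) (snd c) e = P v"
        using v(3,4) is_chart_inj_on[OF chart] by simp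
      moreover have "induced_inv (P v) = q v" using induced_inv_P[of v] v(2) W(2) by blast
      ultimately show ?thesis
        using v W(3) V(4) by (simp add: local_rep_def c')
    qed
    moreover have "smooth_on (\<lambda>e. s (inv_into (fst c) (snd c) e)) ?A"
      by (rule smooth_on_subset[OF s]) blast
    ultimately have "smooth_on (local_rep c c' induced_inv) ?A"
      using smooth_on_cong[OF A rep] by simp
    moreover have "e \<in> ?A" using x \<open>x = P w\<close> w V(2) by blast
    ultimately show "\<exists>T. open T \<and> e \<in> T \<and> smooth_on (local_rep c c' induced_inv) T"
      using A by blast
  qed
  then have "smooth_map X Q induced_inv"
    using cont by (simp add: smooth_map_def)
  with 1 inv show ?thesis
    unfolding diffeomorphism_def by blast
qed

text \<open>With zero symbols on the quotient the transformation law loses its left-hand side. The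
  remaining equation for c o P is formulated on S and passes to every quotient chart, whose
  coordinates are points of S.\<close>

lemma carries_connection_induced:
  assumes "\<And>c y u v. c \<in> atlas X \<Longrightarrow> y \<in> S \<Longrightarrow> P y \<in> fst c \<Longrightarrow>
    derivative2 (\<lambda>z. snd c (P z)) y u v +
      \<Gamma> c (snd c (P y)) (derivative1 (\<lambda>z. snd c (P z)) y u) (derivative1 (\<lambda>z. snd c (P z)) y v) = 0"
  shows "carries_connection Q standard_connection X \<Gamma> induced"
  unfolding carries_connection_def Let_def
proof (intro ballI allI)
  fix c c' y u v
  assume "c \<in> atlas Q" and c': "c' \<in> atlas X" and y: "y \<in> local_dom c c' induced"
  then obtain W where W: "open W" "W \<subseteq> S" "inj_on q W" and c: "c = (q ` W, inv_into W q)"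
    unfolding atlas_Q by blast
  have y: "y \<in> W \<inter> {y \<in> S. P y \<in> fst c'}"
    using y W(2) unfolding c local_dom_Q[OF W(3)] by (auto simp: induced_q subset_iff)
  let ?\<tau> = "local_rep c c' induced" and ?\<sigma> = "\<lambda>z. snd c' (P z)"
  have eq: "?\<tau> z = ?\<sigma> z" if "z \<in> W" for z
    using that W(2) by (auto simp: c local_rep_Q[OF W] induced_q)
  have "linear (derivative1 ?\<sigma> y)"
    using smooth_on_linear[OF smooth[OF c']] y by blast
  moreover have "derivative1 ?\<tau> y = derivative1 ?\<sigma> y" "derivative2 ?\<tau> y = derivative2 ?\<sigma> y"
    using derivative1_cong[OF W(1) _ eq] derivative2_cong[OF W(1) _ eq] y by auto
  ultimately show "derivative1 ?\<tau> y (standard_connection c y u v) = derivative2 ?\<tau> y u v +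
      \<Gamma> c' (?\<tau> y) (derivative1 ?\<tau> y u) (derivative1 ?\<tau> y v)"
    using assms[OF c', of y u v] y eq by (simp add: standard_connection_def linear_0)
qed

end

section \<open>Connections\<close>

lemma is_connection_bilinear:
  "is_connection M \<Gamma> \<Longrightarrow> c \<in> atlas M \<Longrightarrow> y \<in> snd c ` fst c \<Longrightarrow> bilinear (\<Gamma> c y)"
  unfolding is_connection_def by blast

text \<open>The hypothesis says D^2\<tau>(a, b) = - \<Gamma>(D\<tau> a, D\<tau> b). Take its
  derivative along u at a = v, b = w, and subtract the same with u and v exchanged: third
  derivatives and the terms with D^2\<tau>(u, v) cancel, D^2\<tau>(u, w) and D^2\<tau>(v, w) are
  replaced by values of - \<Gamma>, and the curvature is left.\<close>

lemma flat_if_pulls_back_to_zero: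
  fixes X :: "('x, 'e::euclidean_space) manifold" and S :: "'f::real_normed_vector set"
  assumes "etale_map X S P" and conn: "is_connection X \<Gamma>" and tf: "torsion_free X \<Gamma>"
    and zero: "\<And>c y u v. c \<in> atlas X \<Longrightarrow> y \<in> S \<Longrightarrow> P y \<in> fst c \<Longrightarrow>
    derivative2 (\<lambda>z. snd c (P z)) y u v +
      \<Gamma> c (snd c (P y)) (derivative1 (\<lambda>z. snd c (P z)) y u) (derivative1 (\<lambda>z. snd c (P z)) y v) = 0"
  shows "flat X \<Gamma>"
  unfolding flat_def
proof (intro ballI allI)
  interpret etale_map X S P by fact
  fix c e U V W
  assume c: "c \<in> atlas X" and e: "e \<in> snd c ` fst c"
  note chart = smooth_manifold_is_chart[OF manifold c]
  have "e \<in> snd c ` (P ` S \<inter> fst c)"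
    using e smooth_manifold_chart_subset[OF manifold c] surj by blast
  then obtain y where y: "y \<in> S" "P y \<in> fst c" "e = snd c (P y)" by blast
  define \<tau> where "\<tau> = (\<lambda>z. snd c (P z))"
  define A where "A = {y \<in> S. P y \<in> fst c}"
  have A: "open A" "y \<in> A" using open_chart_preimage[OF c] y by (simp_all add: A_def)
  have \<tau>: "smooth_on \<tau> A" using smooth[OF c] by (simp add: \<tau>_def A_def)
  have oC: "open (snd c ` fst c)" using chart by (simp add: is_chart_def)
  have \<tau>y: "\<tau> y = e" by (simp add: \<tau>_def y)
  have bil: "bilinear (\<Gamma> c z)" if "z \<in> snd c ` fst c" for z
    by (rule is_connection_bilinear[OF conn c that])
  have sm: "smooth_on (\<lambda>z. \<Gamma> c z a b) (snd c ` fst c)" for a b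
    using conn c by (simp add: is_connection_def)
  have sym: "\<Gamma> c e a b = \<Gamma> c e b a" for a b
    using tf c e unfolding torsion_free_def by blast
  have zero': "derivative2 \<tau> z a b = - \<Gamma> c (\<tau> z) (derivative1 \<tau> z a) (derivative1 \<tau> z b)" if "z \<in> A" for z a b
    using zero[OF c, of z a b] that by (simp add: \<tau>_def A_def eq_neg_iff_add_eq_0)
  have key: "derivative1 (\<lambda>z. \<Gamma> c z (derivative1 \<tau> y a) (derivative1 \<tau> y b)) e (derivative1 \<tau> y w)
      + \<Gamma> c e (derivative2 \<tau> y w a) (derivative1 \<tau> y b) + \<Gamma> c e (derivative1 \<tau> y a) (derivative2 \<tau> y w b)
      = - derivative2 (\<lambda>z. derivative1 \<tau> z b) y w a" for a b w
  proof -
    have "((\<lambda>z. \<Gamma> c (\<tau> z) (derivative1 \<tau> z a) (derivative1 \<tau> z b)) has_derivative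
      (\<lambda>w. derivative1 (\<lambda>z. \<Gamma> c z (derivative1 \<tau> y a) (derivative1 \<tau> y b)) e (derivative1 \<tau> y w)
      + \<Gamma> c (\<tau> y) (derivative2 \<tau> y w a) (derivative1 \<tau> y b) + \<Gamma> c (\<tau> y) (derivative1 \<tau> y a) (derivative2 \<tau> y w b))) (at y)"
    proof (rule has_derivative_bilinear_family[where T = "snd c ` fst c" and \<beta>' = "\<lambda>a b. derivative1 (\<lambda>z. \<Gamma> c z a b) e"])
      show "open (snd c ` fst c)" by (rule oC)
      show "\<tau> y \<in> snd c ` fst c" using e \<tau>y by simp
      show "bilinear (\<Gamma> c z)" if "z \<in> snd c ` fst c" for z by (rule bil[OF that])
      show "((\<lambda>z. \<Gamma> c z a b) has_derivative derivative1 (\<lambda>z. \<Gamma> c z a b) e) (at (\<tau> y))" for a b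
        unfolding \<tau>y by (rule smooth_on_has_derivative[OF sm e])
      show "(\<tau> has_derivative derivative1 \<tau> y) (at y)" by (rule smooth_on_has_derivative[OF \<tau> A(2)])
      show "((\<lambda>z. derivative1 \<tau> z a) has_derivative (\<lambda>w. derivative2 \<tau> y w a)) (at y)"
        "((\<lambda>z. derivative1 \<tau> z b) has_derivative (\<lambda>w. derivative2 \<tau> y w b)) (at y)"
        by (rule smooth_on_has_derivative2[OF \<tau> A(2)])+
    qed
    moreover have "((\<lambda>z. - derivative1 (\<lambda>z. derivative1 \<tau> z b) z a) has_derivative
        (\<lambda>w. - derivative2 (\<lambda>z. derivative1 \<tau> z b) y w a)) (at y)"
      by (intro has_derivative_minus smooth_on_has_derivative2[OF smooth_on_derivative1[OF \<tau>] A(2)])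
    then have "((\<lambda>z. \<Gamma> c (\<tau> z) (derivative1 \<tau> z a) (derivative1 \<tau> z b)) has_derivative
        (\<lambda>w. - derivative2 (\<lambda>z. derivative1 \<tau> z b) y w a)) (at y)"
      by (rule has_derivative_transform_within_open[OF _ A])
        (use zero' in \<open>simp add: derivative2_def\<close>)
    ultimately have "(\<lambda>w. derivative1 (\<lambda>z. \<Gamma> c z (derivative1 \<tau> y a) (derivative1 \<tau> y b)) e (derivative1 \<tau> y w)
      + \<Gamma> c (\<tau> y) (derivative2 \<tau> y w a) (derivative1 \<tau> y b) + \<Gamma> c (\<tau> y) (derivative1 \<tau> y a) (derivative2 \<tau> y w b))
      = (\<lambda>w. - derivative2 (\<lambda>z. derivative1 \<tau> z b) y w a)"
      by (rule has_derivative_unique)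
    from fun_cong[OF this, of w] show ?thesis by (simp add: \<tau>y)
  qed
  \<comment> \<open>The derivatives of \<tau> are taken along vectors of the source; surjectivity
    makes these reach arbitrary U, V, W of the chart.\<close>
  have "surj (derivative1 \<tau> y)"
    using bij_derivative1[OF c y(1,2)] by (simp add: \<tau>_def bij_is_surj)
  then obtain u v w where UVW: "U = derivative1 \<tau> y u" "V = derivative1 \<tau> y v" "W = derivative1 \<tau> y w"
    by (meson surjD)
  have [simp]: "\<Gamma> c e a (- b) = - \<Gamma> c e a b" for a b
    using bil[OF e] by (rule bilinear_rneg)
  have "derivative2 (\<lambda>z. derivative1 \<tau> z w) y u v = derivative2 (\<lambda>z. derivative1 \<tau> z w) y v u"
    by (rule derivative2_commute[OF A(1) smooth_on_derivative1[OF \<tau>] A(2)])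
  moreover have "derivative2 \<tau> y u v = derivative2 \<tau> y v u"
    "derivative2 \<tau> y u w = - \<Gamma> c e U W" "derivative2 \<tau> y v w = - \<Gamma> c e V W"
    using zero'[OF A(2)] sym by (simp_all add: UVW \<tau>y)
  ultimately have "derivative1 (\<lambda>z. \<Gamma> c z V W) e U =
      \<Gamma> c e V (\<Gamma> c e U W) - \<Gamma> c e (derivative2 \<tau> y v u) W - derivative2 (\<lambda>z. derivative1 \<tau> z w) y v u"
    "derivative1 (\<lambda>z. \<Gamma> c z U W) e V =
      \<Gamma> c e U (\<Gamma> c e V W) - \<Gamma> c e (derivative2 \<tau> y v u) W - derivative2 (\<lambda>z. derivative1 \<tau> z w) y v u"
    using key[of v w u] key[of u w v] unfolding UVW[symmetric] by (simp_all add: algebra_simps)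
  then show "curvature \<Gamma> c e U V W = 0"
    by (simp add: curvature_def)
qed

text \<open>The transformation law is affine in \<Gamma> with inhomogeneous term D^2\<tau>, so it is
  preserved by combinations whose coefficients, here 2 and -1, add up to 1.\<close>

lemma is_connection_dual:
  assumes X: "smooth_manifold X" and g: "is_connection X \<Gamma>g" and D: "is_connection X \<Gamma>"
  shows "is_connection X (dual_connection \<Gamma>g \<Gamma>)"
  unfolding is_connection_def
proof (intro conjI ballI allI)
  fix c y assume "c \<in> atlas X" "y \<in> snd c ` fst c"
  then have "bilinear (\<Gamma>g c y)" "bilinear (\<Gamma> c y)"
    using g D by (auto intro: is_connection_bilinear)
  then show "bilinear (dual_connection \<Gamma>g \<Gamma> c y)"
    by (auto simp: bilinear_def dual_connection_def linear_iff algebra_simps)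
next
  fix c u v assume c: "c \<in> atlas X"
  have o: "open (snd c ` fst c)"
    using smooth_manifold_is_chart[OF X c] by (simp add: is_chart_def)
  have "smooth_on (\<lambda>y. 2 *\<^sub>R \<Gamma>g c y u v + (- 1) *\<^sub>R \<Gamma> c y u v) (snd c ` fst c)"
    using g D c by (intro smooth_on_add o smooth_on_scaleR smooth_on_const) (simp_all add: is_connection_def)
  then show "smooth_on (\<lambda>y. dual_connection \<Gamma>g \<Gamma> c y u v) (snd c ` fst c)"
    by (simp add: dual_connection_def)
next
  show "carries_connection X (dual_connection \<Gamma>g \<Gamma>) X (dual_connection \<Gamma>g \<Gamma>) id"
    unfolding carries_connection_def Let_def
  proof (intro ballI allI)
    fix c c' y u v
    assume c: "c \<in> atlas X" "c' \<in> atlas X" and y: "y \<in> local_dom c c' id"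
    let ?\<tau> = "local_rep c c' id"
    have lin: "linear (derivative1 ?\<tau> y)"
      using X c y by (intro smooth_on_linear[of _ "local_dom c c' id"]) (auto simp: smooth_manifold_def)
    have "derivative1 ?\<tau> y (\<Gamma>' c y u v) =
        derivative2 ?\<tau> y u v + \<Gamma>' c' (?\<tau> y) (derivative1 ?\<tau> y u) (derivative1 ?\<tau> y v)"
      if "is_connection X \<Gamma>'" for \<Gamma>'
      using that c y by (simp add: is_connection_def carries_connection_def Let_def)
    note this[OF g] this[OF D]
    then show "derivative1 ?\<tau> y (dual_connection \<Gamma>g \<Gamma> c y u v) = derivative2 ?\<tau> y u v +
        dual_connection \<Gamma>g \<Gamma> c' (?\<tau> y) (derivative1 ?\<tau> y u) (derivative1 ?\<tau> y v)"
      by (simp add: dual_connection_def linear_diff[OF lin] linear_add[OF lin] algebra_simps scaleR_2)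
  qed
qed

section \<open>Gradient maps\<close>

lemma gradient_map_apply:
  assumes "smooth_on \<Phi> S" "x \<in> S"
  shows "blinfun_apply (gradient_map \<Phi> x) v = derivative1 \<Phi> x v"
  using has_derivative_bounded_linear[OF smooth_on_has_derivative[OF assms]]
  by (simp add: gradient_map_def bounded_linear_Blinfun_apply derivative1_eq)

text \<open>The gradient is a finite sum of fixed covectors whose coefficients, the partial
  derivatives of \<Phi>, are smooth.\<close>

lemma smooth_on_gradient_map:
  fixes \<Phi> :: "'a::euclidean_space \<Rightarrow> real"
  assumes S: "open S" and \<Phi>: "smooth_on \<Phi> S"
  shows "smooth_on (gradient_map \<Phi>) S"
proof -
  have "gradient_map \<Phi> x = (\<Sum>b\<in>Basis. derivative1 \<Phi> x b *\<^sub>R blinfun_inner_right b)" if "x \<in> S" for x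
  proof (rule blinfun_eqI)
    fix v
    show "gradient_map \<Phi> x v = (\<Sum>b\<in>Basis. derivative1 \<Phi> x b *\<^sub>R blinfun_inner_right b) v"
      using linear_Basis_expansion[OF smooth_on_linear[OF \<Phi> that], of v]
      by (simp add: gradient_map_apply[OF \<Phi> that] blinfun.sum_left blinfun.scaleR_left inner_commute mult.commute)
  qed
  moreover have "smooth_on (\<lambda>x. \<Sum>b\<in>Basis. derivative1 \<Phi> x b *\<^sub>R blinfun_inner_right b) S"
    by (intro smooth_on_sum smooth_on_scaleR S smooth_on_derivative1[OF \<Phi>] smooth_on_const)
  ultimately show ?thesis
    by (intro smooth_on_eqI[where f = "gradient_map \<Phi>", OF _ S])
qed

lemma derivative1_gradient_map:
  fixes \<Phi> :: "'a::euclidean_space \<Rightarrow> real"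
  assumes S: "open S" and \<Phi>: "smooth_on \<Phi> S" and x: "x \<in> S"
  shows "blinfun_apply (derivative1 (gradient_map \<Phi>) x u) v = derivative2 \<Phi> x u v"
proof -
  have "((\<lambda>z. blinfun_apply (gradient_map \<Phi> z) v) has_derivative
      (\<lambda>u. blinfun_apply (derivative1 (gradient_map \<Phi>) x u) v)) (at x)"
    by (intro bounded_linear.has_derivative[OF blinfun.bounded_linear_left]
        smooth_on_has_derivative[OF smooth_on_gradient_map[OF S \<Phi>] x])
  then have "((\<lambda>z. derivative1 \<Phi> z v) has_derivative
      (\<lambda>u. blinfun_apply (derivative1 (gradient_map \<Phi>) x u) v)) (at x)"
    by (rule has_derivative_transform_within_open[OF _ S x]) (rule gradient_map_apply[OF \<Phi>])
  then show ?thesis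
    by (simp add: derivative2_def derivative1_unique)
qed

lemma derivative2_gradient_map:
  fixes \<Phi> :: "'a::euclidean_space \<Rightarrow> real"
  assumes S: "open S" and \<Phi>: "smooth_on \<Phi> S" and x: "x \<in> S"
  shows "blinfun_apply (derivative2 (gradient_map \<Phi>) x u v) w = derivative1 (\<lambda>z. derivative2 \<Phi> z v w) x u"
proof -
  have "blinfun_apply (derivative2 (gradient_map \<Phi>) x u v) w
      = derivative2 (\<lambda>z. blinfun_apply (gradient_map \<Phi> z) w) x u v"
    by (rule derivative2_linear_compose[OF blinfun.bounded_linear_left S smooth_on_gradient_map[OF S \<Phi>] x, symmetric])
  also have "\<dots> = derivative2 (\<lambda>z. derivative1 \<Phi> z w) x u v"
    by (subst derivative2_cong[OF S x, where g = "\<lambda>z. derivative1 \<Phi> z w"])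
      (simp_all add: gradient_map_apply[OF \<Phi>])
  finally show ?thesis by (simp add: derivative2_def)
qed

text \<open>Along the segment from x to y, with u = y - x, the directional derivative of \<Phi>
  along u has positive derivative, so the gradients differ at the two ends.\<close>

lemma inj_on_gradient_map:
  fixes \<Phi> :: "'a::euclidean_space \<Rightarrow> real"
  assumes S: "convex S" and \<Phi>: "smooth_on \<Phi> S"
    and pos: "\<And>x u. x \<in> S \<Longrightarrow> u \<noteq> 0 \<Longrightarrow> derivative2 \<Phi> x u u > 0"
  shows "inj_on (gradient_map \<Phi>) S"
proof (rule inj_onI, rule ccontr)
  fix x y assume x: "x \<in> S" and y: "y \<in> S" and eq: "gradient_map \<Phi> x = gradient_map \<Phi> y" and "x \<noteq> y"
  define u where "u = y - x"
  have seg: "x + t *\<^sub>R u \<in> S" if "0 \<le> t" "t \<le> 1" for t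
    using convexD_alt[OF S x y that] by (simp add: u_def algebra_simps)
  have "((\<lambda>t. derivative1 \<Phi> (x + t *\<^sub>R u) u) has_real_derivative derivative2 \<Phi> (x + t *\<^sub>R u) u u) (at t)"
    if "0 \<le> t" "t \<le> 1" for t
    unfolding has_real_derivative_iff_has_vector_derivative derivative2_def
    by (rule smooth_on_line_derivative[OF smooth_on_derivative1[OF \<Phi>] seg[OF that]])
  from MVT2[OF zero_less_one this] obtain t where "0 < t" "t < 1"
    "derivative1 \<Phi> (x + 1 *\<^sub>R u) u - derivative1 \<Phi> (x + 0 *\<^sub>R u) u = (1 - 0) * derivative2 \<Phi> (x + t *\<^sub>R u) u u"
    by blast
  moreover have "derivative1 \<Phi> x u = derivative1 \<Phi> y u"
    using gradient_map_apply[OF \<Phi>, of _ u] x y eq by metis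
  ultimately show False
    using pos[OF seg, of t u] \<open>x \<noteq> y\<close> by (simp add: u_def)
qed

text \<open>The inverse function argument works with matrices on \<open>real ^ 'n\<close>, so the
  dual space is identified with it by J, which represents a functional by the vector of its inner
  product.\<close>

lemma gradient_map_diffeomorphic:
  fixes \<Phi> :: "real ^ 'n \<Rightarrow> real"
  assumes S: "open S" "convex S" and \<Phi>: "smooth_on \<Phi> S"
    and pos: "\<And>x u. x \<in> S \<Longrightarrow> u \<noteq> 0 \<Longrightarrow> derivative2 \<Phi> x u u > 0"
  shows "open (gradient_map \<Phi> ` S)" "smooth_on (inv_into S (gradient_map \<Phi>)) (gradient_map \<Phi> ` S)"
proof -
  let ?F = "gradient_map \<Phi>"
  define J :: "((real ^ 'n) \<Rightarrow>\<^sub>L real) \<Rightarrow> real ^ 'n" where "J = (\<lambda>f. \<Sum>b\<in>Basis. blinfun_apply f b *\<^sub>R b)"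
  have J: "bounded_linear J"
    unfolding J_def by (intro bounded_linear_sum bounded_linear_scaleR_const blinfun.bounded_linear_left)
  have J_inner: "J f \<bullet> v = blinfun_apply f v" for f v
    using linear_Basis_expansion[OF bounded_linear.linear[OF blinfun.bounded_linear_right[of f]], of v]
    by (simp add: J_def inner_sum_left inner_sum_right inner_commute mult.commute)
  have injJ: "J f = J f' \<Longrightarrow> f = f'" for f f'
    by (rule blinfun_eqI) (metis J_inner)
  note injF = inj_on_gradient_map[OF S(2) \<Phi> pos]
  have F: "smooth_on ?F S" by (rule smooth_on_gradient_map[OF S(1) \<Phi>])
  let ?H = "\<lambda>x. J (?F x)"
  have H: "smooth_on ?H S" by (rule smooth_on_linear_compose[OF J S(1) F])
  have injH: "inj_on ?H S" using injF injJ by (metis (mono_tags, lifting) inj_on_def)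
  \<comment> \<open>The inner product of DH(x) v with v is the Hessian at (v, v), so positivity
    excludes a nonzero kernel vector.\<close>
  have ker: "v = 0" if x: "x \<in> S" and v: "derivative1 ?H x v = 0" for x v
  proof (rule ccontr)
    assume "v \<noteq> 0"
    have "(?H has_derivative (\<lambda>u. J (derivative1 ?F x u))) (at x)"
      by (intro bounded_linear.has_derivative[OF J] smooth_on_has_derivative[OF F x])
    then have "derivative1 ?H x v = J (derivative1 ?F x v)" by (simp add: derivative1_unique)
    then have "J (derivative1 ?F x v) \<bullet> v = 0" using v by simp
    then show False
      using pos[OF x \<open>v \<noteq> 0\<close>] by (simp add: J_inner derivative1_gradient_map[OF S(1) \<Phi> x])
  qed
  note inv = smooth_on_inv_into[OF S(1) H injH ker]
  have "?F ` S = J -` ?H ` S" using injJ by auto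
  then show oF: "open (?F ` S)"
    using open_vimage[OF inv(1) linear_continuous_on[OF J]] by simp
  have "smooth_on (\<lambda>\<xi>. inv_into S ?H (J \<xi>)) (?F ` S)"
  proof (rule smooth_on_compose[OF oF inv(1) _ inv(2)])
    show "smooth_on J (?F ` S)" using smooth_on_affine[OF J, of 0] by simp
  qed auto
  moreover have "inv_into S ?F \<xi> = inv_into S ?H (J \<xi>)" if "\<xi> \<in> ?F ` S" for \<xi>
    using that inv_into_f_f[OF injF] inv_into_f_f[OF injH] by auto
  ultimately show "smooth_on (inv_into S ?F) (?F ` S)"
    by (intro smooth_on_eqI[where f = "inv_into S ?F", OF _ oF])
qed

section \<open>The dual connection on a quotient of a convex domain\<close>

lemma local_rep_domain_manifold:
  "z \<in> S \<Longrightarrow> local_rep (S, id) c f z = snd c (f z)"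
  using inv_into_f_f[of id S z] by (simp add: local_rep_def)

lemma local_dom_domain_manifold:
  "local_dom (S, id) c f = {z \<in> S. f z \<in> fst c}"
  by (auto simp: local_dom_def)

locale hessian_cover = etale_map X \<Omega> p
  for X :: "('x, real ^ 'n) manifold" and \<Omega> and p +
  fixes D Dg :: "('x, real ^ 'n) connection" and g :: "('x, real ^ 'n) metric"
    and \<Phi> :: "real ^ 'n \<Rightarrow> real"
  assumes convex: "convex \<Omega>"
    and potential: "smooth_on \<Phi> \<Omega>"
    and metric: "riemannian_metric X g"
    and connection: "is_connection X D" "torsion_free X D"
    and levi_civita: "levi_civita_connection X g Dg"
    and carries: "carries_connection (domain_manifold \<Omega>) standard_connection X D p"
    and pulls_back: "pulls_back_metric (domain_manifold \<Omega>) (\<lambda>_. derivative2 \<Phi>) X g p"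
begin

abbreviation "F \<equiv> gradient_map \<Phi>"
abbreviation "F_inv \<equiv> inv_into \<Omega> F"

definition chart_dom :: "('x, real ^ 'n) chart \<Rightarrow> (real ^ 'n) set" where
  "chart_dom c = {x \<in> \<Omega>. p x \<in> fst c}"

definition coord :: "('x, real ^ 'n) chart \<Rightarrow> real ^ 'n \<Rightarrow> real ^ 'n" where
  "coord c = (\<lambda>x. snd c (p x))"

lemma open_chart_dom: "c \<in> atlas X \<Longrightarrow> open (chart_dom c)"
  unfolding chart_dom_def by (rule open_chart_preimage)

lemma chart_dom_subset: "chart_dom c \<subseteq> \<Omega>"
  by (auto simp: chart_dom_def)

lemma smooth_coord: "c \<in> atlas X \<Longrightarrow> smooth_on (coord c) (chart_dom c)"
  unfolding coord_def chart_dom_def by (rule smooth)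

lemma coord_in_chart: "x \<in> chart_dom c \<Longrightarrow> coord c x \<in> snd c ` fst c"
  by (auto simp: coord_def chart_dom_def)

lemma bij_derivative1_coord: "c \<in> atlas X \<Longrightarrow> x \<in> chart_dom c \<Longrightarrow> bij (derivative1 (coord c) x)"
  unfolding coord_def chart_dom_def by (rule bij_derivative1) auto

lemma ex_chart_dom: "x \<in> \<Omega> \<Longrightarrow> \<exists>c\<in>atlas X. x \<in> chart_dom c"
  using smooth_manifold_ex_chart[OF manifold, of "p x"] surj by (auto simp: chart_dom_def)

section \<open>The connection and the metric in the coordinates of \<Omega>\<close>

lemma derivative_local_rep:
  assumes "c \<in> atlas X" "x \<in> chart_dom c"
  shows "derivative1 (local_rep (\<Omega>, id) c p) x = derivative1 (coord c) x"
    "derivative2 (local_rep (\<Omega>, id) c p) x = derivative2 (coord c) x"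
proof -
  have "local_rep (\<Omega>, id) c p z = coord c z" if "z \<in> chart_dom c" for z
    using that by (simp add: coord_def chart_dom_def local_rep_domain_manifold)
  then show "derivative1 (local_rep (\<Omega>, id) c p) x = derivative1 (coord c) x"
    "derivative2 (local_rep (\<Omega>, id) c p) x = derivative2 (coord c) x"
    using assms by (auto intro: derivative1_cong[OF open_chart_dom] derivative2_cong[OF open_chart_dom])
qed

lemma hessian_eq:
  assumes "c \<in> atlas X" "x \<in> chart_dom c"
  shows "derivative2 \<Phi> x u v = g c (coord c x) (derivative1 (coord c) x u) (derivative1 (coord c) x v)"
proof -
  have "x \<in> local_dom (\<Omega>, id) c p"
    using assms(2) by (simp add: local_dom_domain_manifold chart_dom_def)
  then have "derivative2 \<Phi> x u v = g c (local_rep (\<Omega>, id) c p x)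
      (derivative1 (local_rep (\<Omega>, id) c p) x u) (derivative1 (local_rep (\<Omega>, id) c p) x v)"
    using pulls_back assms(1) unfolding pulls_back_metric_def Let_def domain_manifold_def by simp
  moreover have "local_rep (\<Omega>, id) c p x = coord c x"
    using assms(2) by (simp add: coord_def chart_dom_def local_rep_domain_manifold)
  ultimately show ?thesis
    by (simp add: derivative_local_rep[OF assms])
qed

text \<open>Since the symbols on \<Omega> vanish, this is what it means that p pulls D back to the
  standard connection; it is the model of the equation for the dual connection and p o
  \<open>F_inv\<close>.\<close>

lemma derivative2_coord:
  assumes "c \<in> atlas X" "x \<in> chart_dom c"
  shows "derivative2 (coord c) x u v = - D c (coord c x) (derivative1 (coord c) x u) (derivative1 (coord c) x v)"
proof -
  have "x \<in> local_dom (\<Omega>, id) c p"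
    using assms(2) by (simp add: local_dom_domain_manifold chart_dom_def)
  then have "derivative1 (local_rep (\<Omega>, id) c p) x 0 = derivative2 (local_rep (\<Omega>, id) c p) x u v
      + D c (local_rep (\<Omega>, id) c p x)
      (derivative1 (local_rep (\<Omega>, id) c p) x u) (derivative1 (local_rep (\<Omega>, id) c p) x v)"
    using carries assms(1)
    unfolding carries_connection_def Let_def domain_manifold_def standard_connection_def by simp
  moreover have "local_rep (\<Omega>, id) c p x = coord c x"
    using assms(2) by (simp add: coord_def chart_dom_def local_rep_domain_manifold)
  moreover have "derivative1 (coord c) x 0 = 0"
    using smooth_on_linear[OF smooth_coord[OF assms(1)] assms(2)] by (rule linear_0)
  ultimately show ?thesis
    by (simp add: derivative_local_rep[OF assms] eq_neg_iff_add_eq_0)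
qed

lemma metric_facts:
  assumes "c \<in> atlas X" "e \<in> snd c ` fst c"
  shows "bilinear (g c e)" "g c e a b = g c e b a" "a \<noteq> 0 \<Longrightarrow> g c e a a > 0"
    "((\<lambda>z. g c z a b) has_derivative derivative1 (\<lambda>z. g c z a b) e) (at e)"
proof -
  have "smooth_on (\<lambda>z. g c z a b) (snd c ` fst c)"
    using metric assms(1) unfolding riemannian_metric_def by blast
  then show "((\<lambda>z. g c z a b) has_derivative derivative1 (\<lambda>z. g c z a b) e) (at e)"
    by (rule smooth_on_has_derivative[OF _ assms(2)])
qed (use metric assms in \<open>unfold riemannian_metric_def, blast+\<close>)

lemma hessian_pos:
  assumes "x \<in> \<Omega>" "u \<noteq> 0"
  shows "derivative2 \<Phi> x u u > 0"
proof -
  obtain c where c: "c \<in> atlas X" "x \<in> chart_dom c" using ex_chart_dom[OF assms(1)] by blast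
  have "derivative1 (coord c) x u \<noteq> derivative1 (coord c) x 0"
    using bij_derivative1_coord[OF c] assms(2) by (metis bij_pointE)
  then have "derivative1 (coord c) x u \<noteq> 0"
    using smooth_on_linear[OF smooth_coord[OF c(1)] c(2)] by (simp add: linear_0)
  then show ?thesis
    using metric_facts(3)[OF c(1) coord_in_chart[OF c(2)]] by (simp add: hessian_eq[OF c])
qed

lemma smooth_F: "smooth_on F \<Omega>"
  by (rule smooth_on_gradient_map[OF open_S potential])

lemma inj_F: "inj_on F \<Omega>"
  by (rule inj_on_gradient_map[OF convex potential hessian_pos])

lemma open_F_image: "open (F ` \<Omega>)" and smooth_F_inv: "smooth_on F_inv (F ` \<Omega>)"
  by (rule gradient_map_diffeomorphic[OF open_S convex potential hessian_pos]; assumption)+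

lemma F_inv_F [simp]: "x \<in> \<Omega> \<Longrightarrow> F_inv (F x) = x"
  using inj_F by simp

lemma etale_map_dual: "etale_map X (F ` \<Omega>) (\<lambda>\<xi>. p (F_inv \<xi>))"
  by (rule etale_map_reparametrize[OF etale_map_axioms open_F_image inj_F smooth_F smooth_F_inv])

text \<open>The third derivative of the potential is totally symmetric, so it is twice the difference
  tensor \<open>\<nabla>\<^sub>g - \<nabla>\<close> lowered by the metric.\<close>

lemma third_derivative_eq:
  assumes c: "c \<in> atlas X" and x: "x \<in> chart_dom c"
  shows "derivative1 (\<lambda>z. derivative2 \<Phi> z v w) x u =
    2 * g c (coord c x) (Dg c (coord c x) (derivative1 (coord c) x u) (derivative1 (coord c) x v)
      - D c (coord c x) (derivative1 (coord c) x u) (derivative1 (coord c) x v)) (derivative1 (coord c) x w)"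
proof -
  let ?\<sigma> = "coord c" and ?d = "derivative1 (coord c) x"
  let ?e = "?\<sigma> x"
  note e = coord_in_chart[OF x]
  have x\<Omega>: "x \<in> \<Omega>" using x chart_dom_subset by blast
  define T where "T u v w = derivative1 (\<lambda>z. derivative2 \<Phi> z v w) x u" for u v w
  \<comment> \<open>The difference tensor of the two connections, lowered by g and evaluated on
    vectors of \<Omega>.\<close>
  define k where "k u v w = g c ?e (Dg c ?e (?d u) (?d v) - D c ?e (?d u) (?d v)) (?d w)" for u v w
  note bil = metric_facts(1)[OF c e]
  have LC: "derivative1 (\<lambda>z. g c z v w) ?e u = g c ?e (Dg c ?e u v) w + g c ?e v (Dg c ?e u w)" for u v w
    using levi_civita c e unfolding levi_civita_connection_def by blast
  \<comment> \<open>In the Leibniz rule for g(D\<sigma> v, D\<sigma> w) the derivative of g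
    contributes the Levi-Civita terms, by metric compatibility, and the second derivatives of
    \<sigma> contribute those of -D.\<close>
  have "T u v w = k u v w + k u w v" for u v w
  proof -
    have "((\<lambda>z. g c (?\<sigma> z) (derivative1 ?\<sigma> z v) (derivative1 ?\<sigma> z w)) has_derivative
      (\<lambda>u. derivative1 (\<lambda>z. g c z (?d v) (?d w)) ?e (?d u)
        + g c ?e (derivative2 ?\<sigma> x u v) (?d w) + g c ?e (?d v) (derivative2 ?\<sigma> x u w))) (at x)"
    proof (rule has_derivative_bilinear_family[where T = "snd c ` fst c" and \<beta>' = "\<lambda>a b. derivative1 (\<lambda>z. g c z a b) ?e"])
      show "open (snd c ` fst c)"
        using smooth_manifold_is_chart[OF manifold c] by (simp add: is_chart_def)
      show "?\<sigma> x \<in> snd c ` fst c" by (rule e)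
      show "bilinear (g c z)" if "z \<in> snd c ` fst c" for z by (rule metric_facts(1)[OF c that])
      show "((\<lambda>z. g c z a b) has_derivative derivative1 (\<lambda>z. g c z a b) ?e) (at ?e)" for a b
        by (rule metric_facts(4)[OF c e])
      show "(?\<sigma> has_derivative ?d) (at x)" by (rule smooth_on_has_derivative[OF smooth_coord[OF c] x])
      show "((\<lambda>z. derivative1 ?\<sigma> z v) has_derivative (\<lambda>u. derivative2 ?\<sigma> x u v)) (at x)"
        "((\<lambda>z. derivative1 ?\<sigma> z w) has_derivative (\<lambda>u. derivative2 ?\<sigma> x u w)) (at x)"
        by (rule smooth_on_has_derivative2[OF smooth_coord[OF c] x])+
    qed
    then have "((\<lambda>z. derivative2 \<Phi> z v w) has_derivative
      (\<lambda>u. derivative1 (\<lambda>z. g c z (?d v) (?d w)) ?e (?d u)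
        + g c ?e (derivative2 ?\<sigma> x u v) (?d w) + g c ?e (?d v) (derivative2 ?\<sigma> x u w))) (at x)"
      by (rule has_derivative_transform_within_open[OF _ open_chart_dom[OF c] x]) (simp add: hessian_eq[OF c])
    from fun_cong[OF derivative1_unique[OF this], of u] show ?thesis
      unfolding T_def k_def
      by (simp add: LC derivative2_coord[OF c x] bilinear_lneg[OF bil] bilinear_rneg[OF bil]
          bilinear_lsub[OF bil] bilinear_rsub[OF bil] metric_facts(2)[OF c e, of _ "?d v"])
  qed
  moreover have "k u v w = k v u w" for u v w
  proof -
    have "\<Gamma> c ?e a b = \<Gamma> c ?e b a" if "torsion_free X \<Gamma>" for \<Gamma> a b
      using that c e unfolding torsion_free_def by blast
    then show ?thesis
      using levi_civita connection(2) unfolding k_def levi_civita_connection_def by metis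
  qed
  moreover have "T u v w = T v u w" for u v w
    using derivative2_commute[OF open_S smooth_on_derivative1[OF potential] x\<Omega>, of w u v]
    by (simp add: T_def derivative2_def)
  moreover have "T u v w = T u w v" for u v w
    unfolding T_def
    by (rule fun_cong[OF derivative1_cong[OF open_S x\<Omega>]]) (rule derivative2_commute[OF open_S potential])
  \<comment> \<open>T(u, v, w) = T(v, u, w) and the symmetry of k in its first two arguments give
    k(u, w, v) = k(v, w, u). So k is totally symmetric and the two summands of T agree.\<close>
  ultimately have "T u v w = 2 * k u v w" by (smt (verit))
  then show ?thesis by (simp add: T_def k_def)
qed

text \<open>Two derivatives of F o \<open>F_inv\<close> = id give D^2F(u, v) + DF(z) = 0, where z is
  the second derivative of \<open>F_inv\<close>. Evaluated at w this reads D^3\<Phi>(u, v, w) +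
  D^2\<Phi>(z, w) = 0, that is g(D\<sigma> z + 2K, D\<sigma> w) = 0 for all w. So D\<sigma> z = -2K,
  which is inserted into the chain rule for \<sigma> o \<open>F_inv\<close>.\<close>

lemma dual_connection_pulls_back_to_zero:
  assumes c: "c \<in> atlas X" and y: "y \<in> F ` \<Omega>" "p (F_inv y) \<in> fst c"
  shows "derivative2 (\<lambda>z. snd c (p (F_inv z))) y \<xi> \<eta>
    + dual_connection Dg D c (snd c (p (F_inv y))) (derivative1 (\<lambda>z. snd c (p (F_inv z))) y \<xi>)
      (derivative1 (\<lambda>z. snd c (p (F_inv z))) y \<eta>) = 0"
proof -
  define x where "x = F_inv y"
  have x\<Omega>: "x \<in> \<Omega>" using y by (auto simp: x_def)
  have x: "x \<in> chart_dom c" using x\<Omega> y by (simp add: chart_dom_def x_def)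
  let ?A = "{y \<in> F ` \<Omega>. p (F_inv y) \<in> fst c}"
  interpret dual: etale_map X "F ` \<Omega>" "\<lambda>\<xi>. p (F_inv \<xi>)" by (rule etale_map_dual)
  have A: "open ?A" "y \<in> ?A" "F_inv ` ?A \<subseteq> chart_dom c"
    using dual.open_chart_preimage[OF c] y by (auto simp: chart_dom_def)
  have G: "smooth_on F_inv ?A" by (rule smooth_on_subset[OF smooth_F_inv]) blast
  let ?\<sigma> = "coord c" and ?d = "derivative1 (coord c) x"
  let ?e = "?\<sigma> x"
  note e = coord_in_chart[OF x]
  note bil = metric_facts(1)[OF c e]
  note lin = smooth_on_linear[OF smooth_coord[OF c] x]
  define u v z where "u = derivative1 F_inv y \<xi>" and "v = derivative1 F_inv y \<eta>"
    and "z = derivative2 F_inv y \<xi> \<eta>"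
  have \<tau>: "(\<lambda>z. snd c (p (F_inv z))) = (\<lambda>z. ?\<sigma> (F_inv z))" by (simp add: coord_def)
  have d1: "derivative1 (\<lambda>z. ?\<sigma> (F_inv z)) y = (\<lambda>\<xi>. ?d (derivative1 F_inv y \<xi>))"
    using derivative1_compose[OF smooth_coord[OF c] G _ A(2)] x by (simp add: x_def)
  have d2: "derivative2 (\<lambda>z. ?\<sigma> (F_inv z)) y \<xi> \<eta> = derivative2 ?\<sigma> x u v + ?d z"
    using derivative2_compose[OF A(1) open_chart_dom[OF c] A(3) smooth_coord[OF c] G A(2)]
    by (simp add: u_def v_def z_def x_def)
  have "derivative2 F x u v + derivative1 F x z = derivative2 (\<lambda>z. F (F_inv z)) y \<xi> \<eta>"
    using derivative2_compose[OF open_F_image open_S _ smooth_F smooth_F_inv y(1)]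
    by (simp add: u_def v_def z_def x_def image_subset_iff)
  \<comment> \<open>Written as z + 0 to match the form L z + c in
    \<open>derivative2_affine\<close>.\<close>
  also have "\<dots> = derivative2 (\<lambda>z. z + 0) y \<xi> \<eta>"
    by (subst derivative2_cong[OF open_F_image y(1), where g = "\<lambda>z. z + 0"]) auto
  also have "\<dots> = 0" by (rule derivative2_affine[OF bounded_linear_ident])
  finally have F0: "derivative2 F x u v + derivative1 F x z = 0" .
  define K where "K = Dg c ?e (?d u) (?d v) - D c ?e (?d u) (?d v)"
  have orth: "g c ?e (?d z + 2 *\<^sub>R K) (?d w) = 0" for w
  proof -
    have "derivative1 (\<lambda>z. derivative2 \<Phi> z v w) x u + derivative2 \<Phi> x z w = 0"
      using arg_cong[OF F0, of "\<lambda>f. blinfun_apply f w"]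
      by (simp add: blinfun.add_left derivative1_gradient_map[OF open_S potential x\<Omega>]
          derivative2_gradient_map[OF open_S potential x\<Omega>])
    then show ?thesis
      by (simp add: third_derivative_eq[OF c x] hessian_eq[OF c x] bilinear_ladd[OF bil]
          bilinear_lmul[OF bil] K_def)
  qed
  \<comment> \<open>Surjectivity of D\<sigma> allows the vector to be paired with itself; positivity
    of g then makes it zero.\<close>
  obtain w where w: "?d w = ?d z + 2 *\<^sub>R K"
    using bij_derivative1_coord[OF c x] by (metis bij_pointE)
  have "?d z + 2 *\<^sub>R K = 0"
    using orth[of w] metric_facts(3)[OF c e, of "?d z + 2 *\<^sub>R K"] unfolding w by fastforce
  moreover have "snd c (p (F_inv y)) = ?e" by (simp add: coord_def x_def)
  ultimately show ?thesis
    unfolding \<tau> d1 d2 using derivative2_coord[OF c x, of u v]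
    by (simp add: dual_connection_def K_def u_def[symmetric] v_def[symmetric] algebra_simps scaleR_2)
qed

lemma affine_manifold_dual: "affine_manifold X (dual_connection Dg D)"
proof -
  have Dg: "is_connection X Dg" "torsion_free X Dg"
    using levi_civita by (simp_all add: levi_civita_connection_def)
  have 1: "is_connection X (dual_connection Dg D)"
    by (rule is_connection_dual[OF manifold Dg(1) connection(1)])
  have 2: "torsion_free X (dual_connection Dg D)"
    using Dg(2) connection(2) by (simp add: torsion_free_def dual_connection_def)
  have "flat X (dual_connection Dg D)"
    by (rule flat_if_pulls_back_to_zero[OF etale_map_dual 1 2 dual_connection_pulls_back_to_zero])
  with 1 2 manifold show ?thesis by (simp add: affine_manifold_def)
qed

text \<open>An affine deck transformation leaves the Hessian of the potential invariant, hence acts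
  on gradients by its contragredient linear part and a translation.\<close>

lemma gradient_deck_affine:
  assumes h: "affine_transformation h" "h ` \<Omega> = \<Omega>" and ph: "\<And>x. x \<in> \<Omega> \<Longrightarrow> p (h x) = p x"
  obtains L b where "bounded_linear L" "\<And>x. x \<in> \<Omega> \<Longrightarrow> F (h x) = L (F x) + b"
proof -
  obtain A a where A: "linear A" "bij A" and h_eq: "h = (\<lambda>x. A x + a)"
    using h(1) by (auto simp: affine_transformation_def)
  have hD: "(h has_derivative A) (at x)" for x
    unfolding h_eq using A(1) by (auto intro!: derivative_eq_intros linear_imp_has_derivative)
  have h\<Omega>: "h x \<in> \<Omega>" if "x \<in> \<Omega>" for x using h(2) that by blast
  have hess: "derivative2 \<Phi> x u v = derivative2 \<Phi> (h x) (A u) (A v)" if "x \<in> \<Omega>" for x u v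
  proof -
    obtain c where c: "c \<in> atlas X" "x \<in> chart_dom c" using ex_chart_dom[OF \<open>x \<in> \<Omega>\<close>] by blast
    have hx: "h x \<in> chart_dom c" using c(2) h\<Omega> ph by (simp add: chart_dom_def)
    \<comment> \<open>h moves points within the fibres of p, so z and h z have the same coordinates
      in c; differentiating this at x relates D\<sigma> at x and at h x through A.\<close>
    have eq: "coord c (h z) = coord c z" if "z \<in> chart_dom c" for z
      using that ph by (simp add: coord_def chart_dom_def)
    have "((\<lambda>z. coord c (h z)) has_derivative (\<lambda>u. derivative1 (coord c) (h x) (A u))) (at x)"
      by (rule has_derivative_compose[OF hD smooth_on_has_derivative[OF smooth_coord[OF c(1)] hx]])
    then have "(coord c has_derivative (\<lambda>u. derivative1 (coord c) (h x) (A u))) (at x)"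
      by (rule has_derivative_transform_within_open[OF _ open_chart_dom[OF c(1)] c(2) eq])
    then have "derivative1 (coord c) x = (\<lambda>u. derivative1 (coord c) (h x) (A u))"
      by (rule derivative1_unique)
    then show ?thesis
      by (simp add: hessian_eq[OF c] hessian_eq[OF c(1) hx] eq[OF c(2)])
  qed
  \<comment> \<open>Precomposition with A^-1 is the contragredient action on covectors: by
    \<open>hess\<close>, DF(h x)(A u) takes at v the value that DF(x) u takes at A^-1 v.\<close>
  define B where "B = Blinfun (inv A)"
  have "linear (inv A)"
    using A by (metis bij_is_inj inj_linear_imp_inv_linear)
  then have B: "blinfun_apply B = inv A"
    by (simp add: B_def bounded_linear_Blinfun_apply linear_conv_bounded_linear)
  have AB: "A (blinfun_apply B v) = v" for v
    using A(2) by (simp add: B bij_is_surj surj_f_inv_f)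
  let ?L = "\<lambda>\<xi>. \<xi> o\<^sub>L B"
  have L: "bounded_linear ?L"
    by (rule bounded_bilinear.bounded_linear_left[OF bounded_bilinear_blinfun_compose])
  have "((\<lambda>x. F (h x) - ?L (F x)) has_derivative (\<lambda>u. 0)) (at x within \<Omega>)" if x: "x \<in> \<Omega>" for x
  proof (rule has_derivative_at_withinI)
    have "((\<lambda>x. F (h x) - ?L (F x)) has_derivative
        (\<lambda>u. derivative1 F (h x) (A u) - ?L (derivative1 F x u))) (at x)"
      by (intro has_derivative_diff bounded_linear.has_derivative[OF L]
          smooth_on_has_derivative[OF smooth_F x]
          has_derivative_compose[OF hD smooth_on_has_derivative[OF smooth_F h\<Omega>[OF x]]])
    moreover have "derivative1 F (h x) (A u) - ?L (derivative1 F x u) = 0" for u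
    proof (rule blinfun_eqI)
      fix v
      show "blinfun_apply (derivative1 F (h x) (A u) - ?L (derivative1 F x u)) v = blinfun_apply 0 v"
        using hess[OF x, of u "B v"]
        by (simp add: blinfun.diff_left AB derivative1_gradient_map[OF open_S potential x]
            derivative1_gradient_map[OF open_S potential h\<Omega>[OF x]])
    qed
    ultimately show "((\<lambda>x. F (h x) - ?L (F x)) has_derivative (\<lambda>u. 0)) (at x)" by simp
  qed
  from has_derivative_zero_constant[OF convex this] obtain b
    where "\<And>x. x \<in> \<Omega> \<Longrightarrow> F (h x) - ?L (F x) = b" by blast
  then have "F (h x) = ?L (F x) + b" if "x \<in> \<Omega>" for x
    using that by (metis add.commute diff_add_cancel)
  with L show ?thesis by (rule that)
qed

end

theorem lemma4p2:
  fixes X :: "('x, real ^ 'n) manifold"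
    and D Dg :: "('x, real ^ 'n) connection"
    and g :: "('x, real ^ 'n) metric"
    and \<Omega> :: "(real ^ 'n) set"
    and G :: "(real ^ 'n \<Rightarrow> real ^ 'n) set"
    and p :: "real ^ 'n \<Rightarrow> 'x"
    and \<Phi> :: "real ^ 'n \<Rightarrow> real"
  assumes "hessian_manifold X D g"
    and "compact_space (mtop X)"
    and "\<Omega> \<noteq> {}" and "open \<Omega>" and "convex \<Omega>"
    and "affine_transformation_group G"
    and "\<And>h. h \<in> G \<Longrightarrow> h ` \<Omega> = \<Omega>"
    and "universal_covering \<Omega> X p"
    and "\<And>m m'. m \<in> \<Omega> \<Longrightarrow> m' \<in> \<Omega> \<Longrightarrow> p m = p m' \<longleftrightarrow> m' \<in> orbit G m"
    and "carries_connection (domain_manifold \<Omega>) standard_connection X D p"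
    and "smooth_on \<Phi> \<Omega>" and "strictly_convex_on \<Omega> \<Phi>"
    and "pulls_back_metric (domain_manifold \<Omega>) (\<lambda>_. derivative2 \<Phi>) X g p"
    and "levi_civita_connection X g Dg"
  shows "affinely_isomorphic
           (quotient_manifold (gradient_map \<Phi> ` \<Omega>) (pushed_action \<Omega> (gradient_map \<Phi>) ` G))
           standard_connection
           X (dual_connection Dg D)"
proof -
  have X: "smooth_manifold X" "is_connection X D" "torsion_free X D" "riemannian_metric X g"
    using assms(1) by (simp_all add: hessian_manifold_def affine_manifold_def hessian_metric_def)
  interpret etale_map X \<Omega> p
    by (rule etale_map_universal_covering[OF X(1) \<open>open \<Omega>\<close> \<open>universal_covering \<Omega> X p\<close>])
  interpret hessian_cover X \<Omega> p D Dg g \<Phi>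
    by unfold_locales (fact assms X)+
  let ?G = "pushed_action \<Omega> F ` G"
  \<comment> \<open>F is injective on \<Omega>, so the pushed action of h sends F x to F (h x), and
    the orbit of F x is the image of a whole fibre of p.\<close>
  have orbit_F: "orbit ?G (F x) = F ` {m \<in> \<Omega>. p m = p x}" if x: "x \<in> \<Omega>" for x
  proof -
    have "orbit ?G (F x) = F ` orbit G x"
      using x by (simp add: orbit_def pushed_action_def image_image)
    moreover have "orbit G x \<subseteq> \<Omega>"
      using assms(7) x by (auto simp: orbit_def)
    then have "m \<in> orbit G x \<longleftrightarrow> m \<in> \<Omega> \<and> p m = p x" for m
      using assms(9)[OF x, of m] by (metis subsetD)
    then have "orbit G x = {m \<in> \<Omega>. p m = p x}" by blast
    ultimately show ?thesis by simp
  qed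
  interpret dual: affine_etale_quotient X "F ` \<Omega>" "\<lambda>\<xi>. p (F_inv \<xi>)" ?G
  proof (intro affine_etale_quotient.intro affine_etale_quotient_axioms.intro etale_map_dual)
    fix y y' assume "y \<in> F ` \<Omega>" "y' \<in> F ` \<Omega>"
    then obtain x x' where x: "x \<in> \<Omega>" "y = F x" and x': "x' \<in> \<Omega>" "y' = F x'" by blast
    have "F ` {m \<in> \<Omega>. p m = p x} = F ` {m \<in> \<Omega>. p m = p x'} \<longleftrightarrow> {m \<in> \<Omega>. p m = p x} = {m \<in> \<Omega>. p m = p x'}"
      by (rule inj_on_image_eq_iff[OF inj_F]) auto
    then show "orbit ?G y = orbit ?G y' \<longleftrightarrow> p (F_inv y) = p (F_inv y')"
      using x x' orbit_F by auto
    \<comment> \<open>Points of \<Omega> with the same image in X differ by some h in G; the affine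
      form of its action on gradients supplies L and b.\<close>
    assume "p (F_inv y) = p (F_inv y')"
    then have "x' \<in> orbit G x" using assms(9) x x' by simp
    then obtain h where h: "h \<in> G" "x' = h x" by (auto simp: orbit_def)
    have h\<Omega>: "h m \<in> \<Omega>" if "m \<in> \<Omega>" for m using assms(7)[OF h(1)] that by blast
    have ph: "p (h m) = p m" if "m \<in> \<Omega>" for m
      using assms(9)[OF that h\<Omega>[OF that]] h(1) by (auto simp: orbit_def)
    have "affine_transformation h"
      using assms(6) h(1) by (simp add: affine_transformation_group_def)
    from gradient_deck_affine[OF this assms(7)[OF h(1)] ph] obtain L b
      where L: "bounded_linear L" "\<And>m. m \<in> \<Omega> \<Longrightarrow> F (h m) = L (F m) + b" by metis
    have "L z + b \<in> F ` \<Omega> \<and> p (F_inv (L z + b)) = p (F_inv z)" if z: "z \<in> F ` \<Omega>" for z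
    proof -
      obtain m where m: "m \<in> \<Omega>" "z = F m" using z by blast
      then have "L z + b = F (h m)" using L(2) by simp
      with m h\<Omega> ph show ?thesis by simp
    qed
    then show "\<exists>L c. bounded_linear L \<and> L y + c = y' \<and>
        (\<forall>z\<in>F ` \<Omega>. L z + c \<in> F ` \<Omega> \<and> p (F_inv (L z + c)) = p (F_inv z))"
      using L x x' h(2) by (intro exI[of _ L] exI[of _ b]) simp
  qed
  show ?thesis
    unfolding affinely_isomorphic_def
    using dual.affine_manifold_Q affine_manifold_dual dual.diffeomorphism_induced
      dual.carries_connection_induced[OF dual_connection_pulls_back_to_zero] by blast
qed

end
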